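(* For every $m=0,1,\ldots$, the output $y^\#_m$ of the $m$-th iterative algorithm satisfies $$\|y^\#_m-h(x_0)\|=\mathcal{O}(\varepsilon^{m+1})$$ whenever the tolerance satisfies $\mathrm{TOL}_m=\mathcal{O}(\varepsilon^{m+1})$.
   Context: Setting. Consider the explicit fast--slow system $x'=f(x,y,\varepsilon)$, $\varepsilon y'=g(x,y,\varepsilon)$, with $x\in\mathbf{R}^{N_s}$, $y\in\mathbf{R}^{N_f}$, $'=d/dt$, $0<\varepsilon\ll1$, where $f,g$ are smooth functions of their arguments. On the set $\{z=(x,y): g(z,0)=0\}$ one assumes $\det (D_yg)(z,0)\neq0$. The system has an $N_s$-dimensional, slow, invariant, normally attracting manifold $\mathcal{L}=\{(x,y): x\in K,\ y=h(x)\}$ for some set $K\subset\mathbf{R}^{N_s}$, where $h:K\to\mathbf{R}^{N_f}$ satisfies the invariance equation $g(x,h(x),\varepsilon)-\varepsilon Dh(x)f(x,h(x),\varepsilon)=0$ and has the asymptotic expansion $h=\sum_{i\ge0}\varepsilon^ih_{[i]}$; in particular $g(x,h_{[0]}(x),0)=0$. Normal attractivity implies that all eigenvalues of $(D_yg)(x,h_{[0]}(x),0)$ have negative real parts and are bounded away from zero uniformly over $K$. The $m$-th iterative algorithm. Fix $x_0\in K$ and a number $H>0$ whose magnitude is $\mathcal{O}(\varepsilon)$ ($H/\varepsilon$ being an $\mathcal{O}(1)$, nonzero quantity). Let $L_m(x_0,y)=(-H)^{m+1}\left(\frac{d^{m+1}y}{dt^{m+1}}\right)(x_0,y)$, where the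 time derivative is taken along solutions of the system and evaluated at $(x_0,y)$ (analytically, without differencing), and let $F_m(y)=y-L_m(x_0,y)$. Starting from a seed value $y^{(1)}$, generate $y^{(r+1)}=F_m(y^{(r)})$, $r=1,2,\ldots$. The iteration is terminated when $\|y^{(r+1)}-y^{(r)}\|<\mathrm{TOL}_m$ for some $r\ge1$, where $\mathrm{TOL}_m$ is a prescribed tolerance. The output $y^\#_m$ of the algorithm is the last member of the sequence $\{y^{(r+1)}\}$ so generated.
   Formalization: The bound is shown for outputs in a fixed neighbourhood (independent of ε, H, TOL and the seed) of h_[0](x_0); for arbitrary seeds it fails: f=0, g=-y(y-1)(y-2), h=0, seed 2 outputs 2. K is taken to lie in the closure of its interior. *)

theory Defs
  imports "HOL-Analysis.Analysis" "HOL-Library.Landau_Symbols"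
begin

text \<open>
  \<open>Ck_on k F S\<close>: \<open>F\<close> is of class \<open>C^k\<close> on the open set \<open>S\<close>. On a finite-dimensional space,
  continuity of all iterated directional derivatives is the same as continuity of the iterated
  Frechet derivatives.
\<close>

primrec Ck_on ::
  "nat \<Rightarrow> ('a::real_normed_vector \<Rightarrow> 'b::real_normed_vector) \<Rightarrow> 'a set \<Rightarrow> bool" where
  "Ck_on 0 F S \<longleftrightarrow> continuous_on S F"
| "Ck_on (Suc k) F S \<longleftrightarrow>
     (\<forall>x\<in>S. F differentiable (at x)) \<and>
     (\<forall>v. Ck_on k (\<lambda>x. frechet_derivative F (at x) v) S)"

definition smooth_on ::
  "('a::real_normed_vector \<Rightarrow> 'b::real_normed_vector) \<Rightarrow> 'a set \<Rightarrow> bool" where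
  "smooth_on F S \<longleftrightarrow> open S \<and> (\<forall>k. Ck_on k F S)"

definition Dy ::
  "(real^'s \<Rightarrow> real^'f \<Rightarrow> real \<Rightarrow> real^'f) \<Rightarrow> real^'s \<Rightarrow> real^'f \<Rightarrow> real \<Rightarrow> real^'f^'f" where
  "Dy g x y \<epsilon> = matrix (frechet_derivative (\<lambda>y. g x y \<epsilon>) (at y))"

definition complex_eigenvalue :: "real^'n^'n \<Rightarrow> complex \<Rightarrow> bool" where
  "complex_eigenvalue A \<mu> \<longleftrightarrow>
     (\<exists>v::complex^'n. v \<noteq> 0 \<and> map_matrix complex_of_real A *v v = \<mu> *s v)"

text \<open>
  The vector field of \<open>x' = f(x,y,\<epsilon>)\<close>, \<open>\<epsilon> y' = g(x,y,\<epsilon>)\<close>, and the \<open>k\<close>-th time derivative of \<open>y\<close>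
  along its solutions as a function of the point \<open>(x,y)\<close>, obtained by repeated use of the chain
  rule. The lemma \<open>dt_y_along_solution\<close> below confirms that this is the derivative along solutions.
\<close>

definition vfield ::
  "(real^'s \<Rightarrow> real^'f \<Rightarrow> real \<Rightarrow> real^'s) \<Rightarrow> (real^'s \<Rightarrow> real^'f \<Rightarrow> real \<Rightarrow> real^'f) \<Rightarrow> real
    \<Rightarrow> (real^'s) \<times> (real^'f) \<Rightarrow> (real^'s) \<times> (real^'f)" where
  "vfield f g \<epsilon> = (\<lambda>(x, y). (f x y \<epsilon>, (1 / \<epsilon>) *\<^sub>R g x y \<epsilon>))"

primrec dt_y ::
  "(real^'s \<Rightarrow> real^'f \<Rightarrow> real \<Rightarrow> real^'s) \<Rightarrow> (real^'s \<Rightarrow> real^'f \<Rightarrow> real \<Rightarrow> real^'f) \<Rightarrow> real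
    \<Rightarrow> nat \<Rightarrow> (real^'s) \<times> (real^'f) \<Rightarrow> real^'f" where
  "dt_y f g \<epsilon> 0 = snd"
| "dt_y f g \<epsilon> (Suc k) = (\<lambda>z. frechet_derivative (dt_y f g \<epsilon> k) (at z) (vfield f g \<epsilon> z))"

lemma dt_y_along_solution:
  assumes "(z has_vector_derivative vfield f g \<epsilon> (z t)) (at t)"
    and "dt_y f g \<epsilon> k differentiable (at (z t))"
  shows "((\<lambda>t. dt_y f g \<epsilon> k (z t)) has_vector_derivative dt_y f g \<epsilon> (Suc k) (z t)) (at t)"
proof -
  have "(dt_y f g \<epsilon> k has_derivative frechet_derivative (dt_y f g \<epsilon> k) (at (z t))) (at (z t))"
    using assms(2) by (simp add: frechet_derivative_works)
  from vector_derivative_diff_chain_within[OF assms(1) has_derivative_at_withinI[OF this]]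
  show ?thesis by (simp add: o_def)
qed

definition L_map ::
  "(real^'s \<Rightarrow> real^'f \<Rightarrow> real \<Rightarrow> real^'s) \<Rightarrow> (real^'s \<Rightarrow> real^'f \<Rightarrow> real \<Rightarrow> real^'f) \<Rightarrow> real
    \<Rightarrow> real \<Rightarrow> nat \<Rightarrow> real^'s \<Rightarrow> real^'f \<Rightarrow> real^'f" where
  "L_map f g \<epsilon> H m x0 y = ((- H) ^ (m + 1)) *\<^sub>R dt_y f g \<epsilon> (m + 1) (x0, y)"

definition F_map ::
  "(real^'s \<Rightarrow> real^'f \<Rightarrow> real \<Rightarrow> real^'s) \<Rightarrow> (real^'s \<Rightarrow> real^'f \<Rightarrow> real \<Rightarrow> real^'f) \<Rightarrow> real
    \<Rightarrow> real \<Rightarrow> nat \<Rightarrow> real^'s \<Rightarrow> real^'f \<Rightarrow> real^'f" where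
  "F_map f g \<epsilon> H m x0 y = y - L_map f g \<epsilon> H m x0 y"

text \<open>The iterates \<open>y^(r)\<close> are numbered from \<open>r = 1\<close>, the seed being \<open>y^(1)\<close>.\<close>

definition iterate :: "('a \<Rightarrow> 'a) \<Rightarrow> 'a \<Rightarrow> nat \<Rightarrow> 'a" where
  "iterate F seed r = (F ^^ (r - 1)) seed"

definition algorithm_output ::
  "('a::real_normed_vector \<Rightarrow> 'a) \<Rightarrow> real \<Rightarrow> 'a \<Rightarrow> 'a \<Rightarrow> bool" where
  "algorithm_output F tol seed y \<longleftrightarrow>
     (\<exists>r\<ge>1. norm (iterate F seed (r + 1) - iterate F seed r) < tol \<and>
            (\<forall>s. 1 \<le> s \<and> s < r \<longrightarrow> \<not> norm (iterate F seed (s + 1) - iterate F seed s) < tol) \<and>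
            y = iterate F seed (r + 1))"

text \<open>
  \<open>h \<epsilon> = (\<Sum>i. \<epsilon>^i h\<^sub>i)\<close> as an asymptotic expansion for \<open>\<epsilon> \<rightarrow> 0+\<close>, with remainders that are
  uniform over \<open>K\<close>.
\<close>

definition asymptotic_expansion ::
  "'a set \<Rightarrow> (real \<Rightarrow> 'a \<Rightarrow> 'b::real_normed_vector) \<Rightarrow> (nat \<Rightarrow> 'a \<Rightarrow> 'b) \<Rightarrow> bool" where
  "asymptotic_expansion K h hc \<longleftrightarrow>
     (\<forall>n. \<exists>C. \<forall>\<^sub>F \<epsilon> in at_right 0. \<forall>x\<in>K.
        norm (h \<epsilon> x - (\<Sum>i\<le>n. \<epsilon> ^ i *\<^sub>R hc i x)) \<le> C * \<epsilon> ^ (n + 1))"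

end

theory Submission
  imports Defs
begin

text \<open>
  Multiplied by \<open>\<epsilon>^k\<close>, the \<open>k\<close>-th time derivative of \<open>y\<close> becomes a function \<open>P\<^sub>k(x, y, \<epsilon>)\<close> that is
  smooth up to and through \<open>\<epsilon> = 0\<close>: \<open>P\<^sub>0 = y\<close> and \<open>P\<^sub>k\<^sub>+\<^sub>1\<close> is the derivative of \<open>P\<^sub>k\<close> in the direction
  \<open>(\<epsilon> f, g, 0)\<close>. With \<open>n = m + 1\<close>, the correction \<open>L\<^sub>m\<close> of the algorithm is \<open>(-H/\<epsilon>)^n P\<^sub>n\<close>, and
  \<open>H/\<epsilon>\<close> is bounded below, so termination at an iterate \<open>y'\<close> means that \<open>P\<^sub>n(x\<^sub>0, y', \<epsilon>)\<close> is of the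
  order \<open>\<epsilon>^n\<close> of the tolerance. Two facts turn this residual into an error bound.

  First, \<open>P\<^sub>n\<close> is also of order \<open>\<epsilon>^n\<close> on the slow manifold. Put \<open>q\<^sub>k(x) = P\<^sub>k(x, h(x), \<epsilon>)\<close>; the
  invariance equation gives \<open>q\<^sub>k\<^sub>+\<^sub>1 = \<epsilon> Dq\<^sub>k f\<close>. The derivatives of \<open>h\<close> may a priori blow up as
  \<open>\<epsilon>\<close> tends to 0, but \<open>q\<^sub>k\<^sub>+\<^sub>1\<close>, a smooth function of \<open>(x, h, \<epsilon>)\<close>, inherits from \<open>h\<close> an expansion
  in powers of \<open>\<epsilon>\<close> with continuous coefficients (\<open>expandable_compose\<close>). If \<open>q\<^sub>k\<close> is of order \<open>\<epsilon>^k\<close>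
  and the expansion of \<open>q\<^sub>k\<^sub>+\<^sub>1\<close> began with a power \<open>j \<le> k\<close>, then some component of
  \<open>q\<^sub>k / \<epsilon>^k\<close> would have a derivative along \<open>f\<close> of size at least a multiple of \<open>1/\<epsilon>\<close> on a whole ball. A bounded
  function on a ball cannot do that: subtracting a paraboloid produces an interior maximum, where its
  gradient is controlled by its bound and the radius (\<open>exists_small_derivative\<close>). This yields
  \<open>slow_derivative_order\<close> and, by induction, \<open>scaled_dt_on_slow_manifold\<close>; the case \<open>k = 1\<close> shows
  in particular that the leading coefficient of \<open>h\<close> solves \<open>g = 0\<close> at \<open>\<epsilon> = 0\<close>.

  Secondly, where \<open>g\<close> vanishes and \<open>\<epsilon> = 0\<close>, the partial derivative of \<open>P\<^sub>n\<close> in \<open>y\<close> is the \<open>n\<close>-th power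
  of the invertible map \<open>D\<^sub>yg\<close> (\<open>partial_derivative_scaled_dt\<close>). By continuity, \<open>P\<^sub>n(x\<^sub>0, \<cdot>, \<epsilon>)\<close>
  expands distances near the leading coefficient by a factor bounded below uniformly in small \<open>\<epsilon>\<close>
  (\<open>uniformly_locally_expanding\<close>). Applied to \<open>y'\<close> and \<open>h(x\<^sub>0)\<close>, whose images under \<open>P\<^sub>n\<close> are both of
  order \<open>\<epsilon>^n\<close>, this bounds their distance; the output differs from \<open>y'\<close> by less than the tolerance.
\<close>

section \<open>Functions of class C^k\<close>

lemma Ck_on_Suc_imp: "Ck_on (Suc k) F S \<Longrightarrow> Ck_on k F S"
proof (induction k arbitrary: F)
  case 0
  then show ?case
    by (simp add: continuous_at_imp_continuous_on differentiable_imp_continuous_within)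
next
  case (Suc k)
  then show ?case by (metis Ck_on.simps(2))
qed

lemma Ck_on_mono: "j \<le> k \<Longrightarrow> Ck_on k F S \<Longrightarrow> Ck_on j F S"
  by (induction rule: inc_induct) (blast dest: Ck_on_Suc_imp)+

lemma Ck_on_imp_continuous_on: "Ck_on k F S \<Longrightarrow> continuous_on S F"
  using Ck_on_mono[of 0 k F S] by simp

lemma Ck_on_cong:
  assumes "open S" "\<And>x. x \<in> S \<Longrightarrow> F x = G x" "Ck_on k F S"
  shows "Ck_on k G S"
  using assms(2,3)
proof (induction k arbitrary: F G)
  case 0
  then show ?case using continuous_on_cong[of S S F G] by simp
next
  case (Suc k)
  have G: "(G has_derivative frechet_derivative F (at x)) (at x)" if "x \<in> S" for x
  proof (rule has_derivative_transform_within_open[OF _ assms(1) that])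
    show "(F has_derivative frechet_derivative F (at x)) (at x)"
      using Suc.prems(2) that frechet_derivative_works by (auto simp del: frechet_derivative_works)
  qed (use Suc.prems(1) in auto)
  show ?case
  proof (simp, intro conjI ballI allI)
    show "G differentiable at x" if "x \<in> S" for x
      using G[OF that] by (auto simp: differentiable_def)
    show "Ck_on k (\<lambda>x. frechet_derivative G (at x) v) S" for v
    proof (rule Suc.IH)
      show "Ck_on k (\<lambda>x. frechet_derivative F (at x) v) S"
        using Suc.prems by simp
      show "frechet_derivative F (at x) v = frechet_derivative G (at x) v" if "x \<in> S" for x
        using frechet_derivative_at[OF G[OF that]] by simp
    qed
  qed
qed

text \<open>
  Establishing differentiability through an explicit derivative avoids computing with
  \<open>frechet_derivative\<close>; openness of the set makes the derivative unique.
\<close>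

lemma Ck_on_SucI:
  assumes "open S"
    and "\<And>x. x \<in> S \<Longrightarrow> (F has_derivative F' x) (at x)"
    and "\<And>v. Ck_on k (\<lambda>x. F' x v) S"
  shows "Ck_on (Suc k) F S"
proof (simp, intro conjI ballI allI)
  show "F differentiable at x" if "x \<in> S" for x
    using assms(2)[OF that] by (auto simp: differentiable_def)
  show "Ck_on k (\<lambda>x. frechet_derivative F (at x) v) S" for v
    using Ck_on_cong[OF assms(1) _ assms(3)[of v], of "\<lambda>x. frechet_derivative F (at x) v"]
      frechet_derivative_at[OF assms(2)] by metis
qed

lemma Ck_on_Suc_has_derivative:
  assumes "Ck_on (Suc k) F S" "x \<in> S"
  shows "(F has_derivative frechet_derivative F (at x)) (at x)"
  using assms frechet_derivative_works by auto

lemma Ck_on_frechet_derivative: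
  "Ck_on (Suc k) F S \<Longrightarrow> Ck_on k (\<lambda>x. frechet_derivative F (at x) v) S"
  by simp

lemma Ck_on_const: "open S \<Longrightarrow> Ck_on k (\<lambda>x. c) S"
  by (induction k arbitrary: c) (auto intro!: Ck_on_SucI[where F' = "\<lambda>_ _. 0"] simp del: Ck_on.simps(2))

lemma Ck_on_linear:
  assumes "open S" "bounded_linear L"
  shows "Ck_on k L S"
  by (cases k) (use assms in \<open>auto intro!: Ck_on_SucI[where F' = "\<lambda>_. L"] Ck_on_const
      bounded_linear_imp_has_derivative linear_continuous_on simp del: Ck_on.simps(2)\<close>)

lemma Ck_on_add:
  assumes "open S"
  shows "Ck_on k F S \<Longrightarrow> Ck_on k G S \<Longrightarrow> Ck_on k (\<lambda>x. F x + G x) S"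
proof (induction k arbitrary: F G)
  case 0
  then show ?case by (simp add: continuous_on_add)
next
  case (Suc k)
  show ?case
    by (rule Ck_on_SucI[OF assms has_derivative_add])
      (use Suc in \<open>auto intro: Ck_on_Suc_has_derivative simp del: Ck_on.simps(2),
        auto\<close>)
qed

lemma Ck_on_sum:
  assumes "open S" "\<And>i. i \<in> I \<Longrightarrow> Ck_on k (F i) S"
  shows "Ck_on k (\<lambda>x. \<Sum>i\<in>I. F i x) S"
  using assms(2)
  by (induction I rule: infinite_finite_induct) (auto intro!: Ck_on_const Ck_on_add assms(1))

lemma Ck_on_scaleR:
  fixes F :: "'a::real_normed_vector \<Rightarrow> real"
  assumes "open S"
  shows "Ck_on k F S \<Longrightarrow> Ck_on k G S \<Longrightarrow> Ck_on k (\<lambda>x. F x *\<^sub>R G x) S"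
proof (induction k arbitrary: F G)
  case 0
  then show ?case by (simp add: continuous_on_scaleR)
next
  case (Suc k)
  note k = Ck_on_Suc_imp[OF Suc.prems(1)] Ck_on_Suc_imp[OF Suc.prems(2)]
  show ?case
    by (rule Ck_on_SucI[OF assms has_derivative_scaleR])
      (use Suc k in \<open>auto intro: Ck_on_Suc_has_derivative intro!: Ck_on_add[OF assms] simp del: Ck_on.simps(2),
        auto\<close>)
qed

lemma Ck_on_linear_compose:
  assumes "open S" "bounded_linear L"
  shows "Ck_on k F S \<Longrightarrow> Ck_on k (\<lambda>x. L (F x)) S"
proof (induction k arbitrary: F)
  case 0
  then show ?case using assms by (simp add: bounded_linear.continuous_on)
next
  case (Suc k)
  show ?case
    by (rule Ck_on_SucI[OF assms(1) bounded_linear.has_derivative[OF assms(2)]])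
      (use Suc in \<open>auto intro: Ck_on_Suc_has_derivative simp del: Ck_on.simps(2), auto\<close>)
qed

lemma frechet_derivative_apply_Basis:
  fixes F :: "'a::euclidean_space \<Rightarrow> 'b::real_normed_vector"
  assumes "F differentiable (at z)"
  shows "frechet_derivative F (at z) v
    = (\<Sum>b\<in>Basis. (v \<bullet> b) *\<^sub>R frechet_derivative F (at z) b)"
proof -
  have lin: "linear (frechet_derivative F (at z))"
    using assms linear_frechet_derivative by blast
  have "frechet_derivative F (at z) v
      = frechet_derivative F (at z) (\<Sum>b\<in>Basis. (v \<bullet> b) *\<^sub>R b)"
    by (simp add: euclidean_representation)
  then show ?thesis
    by (simp add: linear_sum[OF lin] linear_scale[OF lin])
qed

lemma Ck_on_frechet_derivative_apply:
  fixes F :: "'a::euclidean_space \<Rightarrow> 'b::real_normed_vector"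
  assumes "open S" "Ck_on (Suc k) F S" "Ck_on k V S"
  shows "Ck_on k (\<lambda>z. frechet_derivative F (at z) (V z)) S"
proof (rule Ck_on_cong[OF assms(1)])
  show "Ck_on k (\<lambda>z. \<Sum>b\<in>Basis. (V z \<bullet> b) *\<^sub>R frechet_derivative F (at z) b) S"
    using assms
    by (intro Ck_on_sum Ck_on_scaleR Ck_on_linear_compose[where L = "\<lambda>v. v \<bullet> b" for b])
      (auto intro: bounded_linear_inner_left)
qed (use assms(2) in \<open>simp add: frechet_derivative_apply_Basis[symmetric]\<close>)

text \<open>
  Only the values on the finitely many basis directions are known to be continuous in the
  point, so the uniform bound on the operator norm is assembled from those.
\<close>

lemma frechet_derivative_bounded_on_compact:
  fixes F :: "'a::euclidean_space \<Rightarrow> 'b::real_normed_vector"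
  assumes "Ck_on (Suc 0) F S" "compact T" "T \<subseteq> S"
  obtains B where "B \<ge> 0" "\<And>z v. z \<in> T \<Longrightarrow> norm (frechet_derivative F (at z) v) \<le> B * norm v"
proof -
  have "\<exists>C. \<forall>z\<in>T. norm (frechet_derivative F (at z) b) \<le> C" for b
  proof -
    have "continuous_on T (\<lambda>z. frechet_derivative F (at z) b)"
      using assms by (auto intro: continuous_on_subset[of S])
    from compact_imp_bounded[OF compact_continuous_image[OF this assms(2)]]
    show ?thesis by (auto simp: bounded_iff)
  qed
  then obtain C where C: "\<And>b z. z \<in> T \<Longrightarrow> norm (frechet_derivative F (at z) b) \<le> C b"
    by metis
  show ?thesis
  proof
    show "(\<Sum>b\<in>Basis. \<bar>C b\<bar>) \<ge> 0" by (simp add: sum_nonneg)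
    fix z v assume z: "z \<in> T"
    have "F differentiable at z" using assms z by auto
    then have "norm (frechet_derivative F (at z) v)
        \<le> (\<Sum>b\<in>Basis. norm ((v \<bullet> b) *\<^sub>R frechet_derivative F (at z) b))"
      using frechet_derivative_apply_Basis[of F z v] norm_sum by metis
    also have "\<dots> \<le> (\<Sum>b\<in>Basis. norm v * \<bar>C b\<bar>)"
    proof (rule sum_mono)
      fix b :: 'a assume "b \<in> Basis"
      then show "norm ((v \<bullet> b) *\<^sub>R frechet_derivative F (at z) b) \<le> norm v * \<bar>C b\<bar>"
        using C[OF z, of b] by (auto intro!: mult_mono Basis_le_norm)
    qed
    finally show "norm (frechet_derivative F (at z) v) \<le> (\<Sum>b\<in>Basis. \<bar>C b\<bar>) * norm v"
      by (simp add: sum_distrib_left[symmetric] mult.commute)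
  qed
qed

section \<open>Uniform expansions in a small parameter\<close>

text \<open>
  An expansion up to order \<open>n\<close>, uniform over \<open>S\<close>. The continuity of the coefficients is what later
  lets a lower bound on a coefficient at one point persist on a ball; for \<open>n = 0\<close> the condition
  says that \<open>u\<close> is uniformly bounded for small parameters.
\<close>

definition expandable ::
  "nat \<Rightarrow> 'a::real_normed_vector set \<Rightarrow> (real \<Rightarrow> 'a \<Rightarrow> 'b::real_normed_vector) \<Rightarrow> bool" where
  "expandable n S u \<longleftrightarrow>
     (\<exists>c C. (\<forall>i<n. continuous_on S (c i) \<and> bounded (c i ` S)) \<and>
       (\<forall>\<^sub>F \<epsilon> in at_right 0. \<forall>x\<in>S. norm (u \<epsilon> x - (\<Sum>i<n. \<epsilon> ^ i *\<^sub>R c i x)) \<le> C * \<epsilon> ^ n))"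

lemma eventually_at_right_0_less: "0 < d \<Longrightarrow> \<forall>\<^sub>F \<epsilon> in at_right (0::real). 0 < \<epsilon> \<and> \<epsilon> < d"
  unfolding eventually_at_right_field by blast

lemma expandableI:
  assumes "\<And>i. i < n \<Longrightarrow> continuous_on S (c i)" "\<And>i. i < n \<Longrightarrow> bounded (c i ` S)"
    and "\<forall>\<^sub>F \<epsilon> in at_right 0. \<forall>x\<in>S. norm (u \<epsilon> x - (\<Sum>i<n. \<epsilon> ^ i *\<^sub>R c i x)) \<le> C * \<epsilon> ^ n"
  shows "expandable n S u"
  using assms unfolding expandable_def by blast

text \<open>
  The constant may be taken nonnegative because only positive parameters matter.
\<close>

lemma expandableE:
  assumes "expandable n S u"
  obtains C c where "C \<ge> 0" "\<forall>i<n. continuous_on S (c i)" "\<forall>i<n. bounded (c i ` S)"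
    "\<forall>\<^sub>F \<epsilon> in at_right 0. \<forall>x\<in>S. norm (u \<epsilon> x - (\<Sum>i<n. \<epsilon> ^ i *\<^sub>R c i x)) \<le> C * \<epsilon> ^ n"
proof -
  from assms obtain c C where c: "\<forall>i<n. continuous_on S (c i) \<and> bounded (c i ` S)"
    and C: "\<forall>\<^sub>F \<epsilon> in at_right 0. \<forall>x\<in>S. norm (u \<epsilon> x - (\<Sum>i<n. \<epsilon> ^ i *\<^sub>R c i x)) \<le> C * \<epsilon> ^ n"
    unfolding expandable_def by blast
  have "\<forall>\<^sub>F \<epsilon> in at_right 0. \<forall>x\<in>S. norm (u \<epsilon> x - (\<Sum>i<n. \<epsilon> ^ i *\<^sub>R c i x)) \<le> \<bar>C\<bar> * \<epsilon> ^ n"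
    using C eventually_at_right_0_less[OF zero_less_one]
  proof eventually_elim
    case (elim \<epsilon>)
    have "C * \<epsilon> ^ n \<le> \<bar>C\<bar> * \<epsilon> ^ n" using elim by (auto intro: mult_right_mono)
    with elim(1) show ?case by (blast intro: order_trans)
  qed
  with c show thesis by (intro that[of "\<bar>C\<bar>" c]) auto
qed

lemma expandable_perturb:
  assumes "expandable n S u"
    and "\<forall>\<^sub>F \<epsilon> in at_right 0. \<forall>x\<in>S. norm (v \<epsilon> x - u \<epsilon> x) \<le> D * \<epsilon> ^ n"
  shows "expandable n S v"
proof -
  obtain C c where C0: "C \<ge> 0"
    and c: "\<forall>i<n. continuous_on S (c i)" "\<forall>i<n. bounded (c i ` S)"
    and C: "\<forall>\<^sub>F \<epsilon> in at_right 0. \<forall>x\<in>S. norm (u \<epsilon> x - (\<Sum>i<n. \<epsilon> ^ i *\<^sub>R c i x)) \<le> C * \<epsilon> ^ n"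
    by (rule expandableE[OF assms(1)])
  note c = c[rule_format]
  show ?thesis
  proof (rule expandableI[OF c])
    show "\<forall>\<^sub>F \<epsilon> in at_right 0. \<forall>x\<in>S. norm (v \<epsilon> x - (\<Sum>i<n. \<epsilon> ^ i *\<^sub>R c i x)) \<le> (D + C) * \<epsilon> ^ n"
      using C assms(2)
    proof eventually_elim
      case (elim \<epsilon>)
      show ?case
      proof
        fix x assume "x \<in> S"
        with elim have "norm (v \<epsilon> x - u \<epsilon> x) \<le> D * \<epsilon> ^ n"
          "norm (u \<epsilon> x - (\<Sum>i<n. \<epsilon> ^ i *\<^sub>R c i x)) \<le> C * \<epsilon> ^ n" by auto
        from norm_triangle_mono[OF this]
        show "norm (v \<epsilon> x - (\<Sum>i<n. \<epsilon> ^ i *\<^sub>R c i x)) \<le> (D + C) * \<epsilon> ^ n"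
          by (simp add: algebra_simps)
      qed
    qed
  qed
qed

lemma expandable_cong:
  assumes "expandable n S u" "\<forall>\<^sub>F \<epsilon> in at_right 0. \<forall>x\<in>S. v \<epsilon> x = u \<epsilon> x"
  shows "expandable n S v"
  by (rule expandable_perturb[OF assms(1), where D = 0]) (use assms(2) in simp)

lemma expandable_zero: "expandable n S (\<lambda>_ _. 0)"
  by (rule expandableI[where c = "\<lambda>_ _. 0" and C = 0]) (auto simp: image_constant_conv)

lemma expandable_add:
  assumes "expandable n S u" "expandable n S v"
  shows "expandable n S (\<lambda>\<epsilon> x. u \<epsilon> x + v \<epsilon> x)"
proof -
  obtain C c where C0: "C \<ge> 0"
    and c: "\<forall>i<n. continuous_on S (c i)" "\<forall>i<n. bounded (c i ` S)"
    and C: "\<forall>\<^sub>F \<epsilon> in at_right 0. \<forall>x\<in>S. norm (u \<epsilon> x - (\<Sum>i<n. \<epsilon> ^ i *\<^sub>R c i x)) \<le> C * \<epsilon> ^ n"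
    by (rule expandableE[OF assms(1)])
  note c = c[rule_format]
  obtain D d where D0: "D \<ge> 0"
    and d: "\<forall>i<n. continuous_on S (d i)" "\<forall>i<n. bounded (d i ` S)"
    and D: "\<forall>\<^sub>F \<epsilon> in at_right 0. \<forall>x\<in>S. norm (v \<epsilon> x - (\<Sum>i<n. \<epsilon> ^ i *\<^sub>R d i x)) \<le> D * \<epsilon> ^ n"
    by (rule expandableE[OF assms(2)])
  note d = d[rule_format]
  show ?thesis
  proof (rule expandableI[where c = "\<lambda>i x. c i x + d i x"])
    show "\<forall>\<^sub>F \<epsilon> in at_right 0. \<forall>x\<in>S.
        norm (u \<epsilon> x + v \<epsilon> x - (\<Sum>i<n. \<epsilon> ^ i *\<^sub>R (c i x + d i x))) \<le> (C + D) * \<epsilon> ^ n"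
      using C D
    proof eventually_elim
      case (elim \<epsilon>)
      show ?case
      proof
        fix x assume "x \<in> S"
        with elim have "norm (u \<epsilon> x - (\<Sum>i<n. \<epsilon> ^ i *\<^sub>R c i x)) \<le> C * \<epsilon> ^ n"
          "norm (v \<epsilon> x - (\<Sum>i<n. \<epsilon> ^ i *\<^sub>R d i x)) \<le> D * \<epsilon> ^ n" by auto
        from norm_triangle_mono[OF this]
        show "norm (u \<epsilon> x + v \<epsilon> x - (\<Sum>i<n. \<epsilon> ^ i *\<^sub>R (c i x + d i x))) \<le> (C + D) * \<epsilon> ^ n"
          by (simp add: algebra_simps sum.distrib)
      qed
    qed
  qed (use c d in \<open>auto intro: continuous_on_add bounded_plus_comp\<close>)
qed

lemma expandable_sum:
  assumes "\<And>i. i \<in> I \<Longrightarrow> expandable n S (u i)"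
  shows "expandable n S (\<lambda>\<epsilon> x. \<Sum>i\<in>I. u i \<epsilon> x)"
  using assms
  by (induction I rule: infinite_finite_induct) (auto intro!: expandable_zero expandable_add)

lemma expandable_scale:
  assumes "expandable n S u" "continuous_on S a" "bounded (a ` S)"
  shows "expandable n S (\<lambda>\<epsilon> x. a x *\<^sub>R u \<epsilon> x)"
proof -
  obtain C c where C0: "C \<ge> 0"
    and c: "\<forall>i<n. continuous_on S (c i)" "\<forall>i<n. bounded (c i ` S)"
    and C: "\<forall>\<^sub>F \<epsilon> in at_right 0. \<forall>x\<in>S. norm (u \<epsilon> x - (\<Sum>i<n. \<epsilon> ^ i *\<^sub>R c i x)) \<le> C * \<epsilon> ^ n"
    by (rule expandableE[OF assms(1)])
  note c = c[rule_format]
  obtain B where B: "\<And>x. x \<in> S \<Longrightarrow> \<bar>a x\<bar> \<le> B" using assms(3) by (auto simp: bounded_iff)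
  have bd: "bounded ((\<lambda>x. a x *\<^sub>R c i x) ` S)" if i: "i < n" for i
  proof -
    obtain D where D: "\<And>x. x \<in> S \<Longrightarrow> norm (c i x) \<le> D" using c(2)[OF i] by (auto simp: bounded_iff)
    have "norm (a x *\<^sub>R c i x) \<le> B * D" if "x \<in> S" for x
      using B[OF that] D[OF that] order_trans[OF abs_ge_zero B[OF that]]
      by (simp add: mult_mono)
    then show ?thesis by (auto simp: bounded_iff)
  qed
  show ?thesis
  proof (rule expandableI[where c = "\<lambda>i x. a x *\<^sub>R c i x"])
    show "\<forall>\<^sub>F \<epsilon> in at_right 0. \<forall>x\<in>S.
        norm (a x *\<^sub>R u \<epsilon> x - (\<Sum>i<n. \<epsilon> ^ i *\<^sub>R a x *\<^sub>R c i x)) \<le> (B * C) * \<epsilon> ^ n"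
      using C
    proof eventually_elim
      case (elim \<epsilon>)
      show ?case
      proof
        fix x assume x: "x \<in> S"
        have "a x *\<^sub>R u \<epsilon> x - (\<Sum>i<n. \<epsilon> ^ i *\<^sub>R a x *\<^sub>R c i x)
            = a x *\<^sub>R (u \<epsilon> x - (\<Sum>i<n. \<epsilon> ^ i *\<^sub>R c i x))"
          by (simp add: scaleR_diff_right scaleR_sum_right mult.commute)
        then show "norm (a x *\<^sub>R u \<epsilon> x - (\<Sum>i<n. \<epsilon> ^ i *\<^sub>R a x *\<^sub>R c i x)) \<le> (B * C) * \<epsilon> ^ n"
          using elim x B[OF x] order_trans[OF abs_ge_zero B[OF x]]
          by (simp add: mult.assoc mult_mono)
      qed
    qed
  qed (use c assms(2) bd in \<open>auto intro: continuous_on_scaleR\<close>)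
qed

lemma expandable_eps:
  assumes "expandable n S u"
  shows "expandable n S (\<lambda>\<epsilon> x. \<epsilon> *\<^sub>R u \<epsilon> x)"
proof -
  obtain C c where C0: "C \<ge> 0"
    and c: "\<forall>i<n. continuous_on S (c i)" "\<forall>i<n. bounded (c i ` S)"
    and C: "\<forall>\<^sub>F \<epsilon> in at_right 0. \<forall>x\<in>S. norm (u \<epsilon> x - (\<Sum>i<n. \<epsilon> ^ i *\<^sub>R c i x)) \<le> C * \<epsilon> ^ n"
    by (rule expandableE[OF assms(1)])
  note c = c[rule_format]
  show ?thesis
  proof (cases n)
    case 0
    show ?thesis
    proof (rule expandableI[where C = C])
      show "\<forall>\<^sub>F \<epsilon> in at_right 0. \<forall>x\<in>S. norm (\<epsilon> *\<^sub>R u \<epsilon> x - (\<Sum>i<n. \<epsilon> ^ i *\<^sub>R c i x)) \<le> C * \<epsilon> ^ n"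
        using C eventually_at_right_0_less[OF zero_less_one]
      proof eventually_elim
        case (elim \<epsilon>)
        have "\<epsilon> * norm (u \<epsilon> x) \<le> 1 * C" if "x \<in> S" for x
          using elim that 0 by (intro mult_mono) auto
        then show ?case using elim 0 by auto
      qed
    qed (use c in auto)
  next
    case (Suc k)
    obtain B where B: "\<And>x. x \<in> S \<Longrightarrow> norm (c k x) \<le> B" using c(2)[of k] Suc by (auto simp: bounded_iff)
    show ?thesis
    proof (rule expandableI[where c = "\<lambda>i. case i of 0 \<Rightarrow> \<lambda>_. 0 | Suc i \<Rightarrow> c i"])
      show "\<forall>\<^sub>F \<epsilon> in at_right 0. \<forall>x\<in>S. norm (\<epsilon> *\<^sub>R u \<epsilon> x
          - (\<Sum>i<n. \<epsilon> ^ i *\<^sub>R (case i of 0 \<Rightarrow> \<lambda>_. 0 | Suc i \<Rightarrow> c i) x)) \<le> (C + B) * \<epsilon> ^ n"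
        using C eventually_at_right_0_less[OF zero_less_one]
      proof eventually_elim
        case (elim \<epsilon>)
        show ?case
        proof
          fix x assume x: "x \<in> S"
          have "norm (\<epsilon> *\<^sub>R (u \<epsilon> x - (\<Sum>i<n. \<epsilon> ^ i *\<^sub>R c i x))) \<le> 1 * (C * \<epsilon> ^ n)"
            unfolding norm_scaleR using elim x by (intro mult_mono) auto
          moreover have "norm (\<epsilon> ^ n *\<^sub>R c k x) \<le> \<epsilon> ^ n * B"
            using elim B[OF x] by simp
          ultimately have "norm (\<epsilon> *\<^sub>R (u \<epsilon> x - (\<Sum>i<n. \<epsilon> ^ i *\<^sub>R c i x)) + \<epsilon> ^ n *\<^sub>R c k x)
              \<le> 1 * (C * \<epsilon> ^ n) + \<epsilon> ^ n * B" by (rule norm_triangle_mono)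
          moreover have "(\<Sum>i<n. \<epsilon> ^ i *\<^sub>R (case i of 0 \<Rightarrow> \<lambda>_. 0 | Suc i \<Rightarrow> c i) x)
              = \<epsilon> *\<^sub>R (\<Sum>i<k. \<epsilon> ^ i *\<^sub>R c i x)"
            unfolding Suc by (simp add: sum.lessThan_Suc_shift scaleR_sum_right del: sum.lessThan_Suc)
          ultimately show "norm (\<epsilon> *\<^sub>R u \<epsilon> x
              - (\<Sum>i<n. \<epsilon> ^ i *\<^sub>R (case i of 0 \<Rightarrow> \<lambda>_. 0 | Suc i \<Rightarrow> c i) x)) \<le> (C + B) * \<epsilon> ^ n"
            unfolding Suc by (simp add: algebra_simps)
        qed
      qed
    qed (use c Suc in \<open>auto split: nat.split simp: image_constant_conv\<close>)
  qed
qed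

lemma expandable_eps_power:
  assumes "expandable n S u"
  shows "expandable n S (\<lambda>\<epsilon> x. \<epsilon> ^ j *\<^sub>R u \<epsilon> x)"
proof (induction j)
  case (Suc j)
  from expandable_eps[OF this] show ?case by simp
qed (use assms in simp)

text \<open>
  Integrating an expansion term by term raises its order by one: by the mean value inequality the
  remainder \<open>O(s^n)\<close> of the derivative integrates to \<open>O(s^(n+1))\<close>. This takes the place of
  Taylor's theorem with parameters.
\<close>

lemma expandable_integrate:
  fixes u u' :: "real \<Rightarrow> 'a::real_normed_vector \<Rightarrow> 'b::real_inner"
  assumes u': "expandable n S u'" and d: "d > 0"
    and deriv: "\<And>s x. \<lbrakk>x \<in> S; -d < s; s < d\<rbrakk> \<Longrightarrow> ((\<lambda>s. u s x) has_vector_derivative u' s x) (at s)"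
    and cont: "continuous_on S (u 0)" and bdd: "bounded (u 0 ` S)"
  shows "expandable (Suc n) S u"
proof -
  obtain C c where C0: "C \<ge> 0"
    and c: "\<forall>i<n. continuous_on S (c i)" "\<forall>i<n. bounded (c i ` S)"
    and b0: "\<forall>\<^sub>F \<epsilon> in at_right 0. \<forall>x\<in>S. norm (u' \<epsilon> x - (\<Sum>i<n. \<epsilon> ^ i *\<^sub>R c i x)) \<le> C * \<epsilon> ^ n"
    by (rule expandableE[OF u'])
  note c = c[rule_format]
  from b0 obtain b where b: "b > 0"
    and C: "\<And>\<epsilon> x. \<lbrakk>0 < \<epsilon>; \<epsilon> < b; x \<in> S\<rbrakk> \<Longrightarrow> norm (u' \<epsilon> x - (\<Sum>i<n. \<epsilon> ^ i *\<^sub>R c i x)) \<le> C * \<epsilon> ^ n"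
    unfolding eventually_at_right_field by blast
  define e where "e i = (case i of 0 \<Rightarrow> u 0 | Suc i \<Rightarrow> \<lambda>x. (1 / (real i + 1)) *\<^sub>R c i x)" for i
  have bd: "bounded (e i ` S)" if "i < Suc n" for i
  proof (cases i)
    case (Suc j)
    have "bounded ((\<lambda>y. (1 / (real j + 1)) *\<^sub>R y) ` (c j ` S))"
      using c(2)[of j] Suc that by (intro bounded_scaling) auto
    then show ?thesis by (simp add: e_def Suc image_image)
  qed (use bdd in \<open>simp add: e_def\<close>)
  show ?thesis
  proof (rule expandableI[where c = e])
    have "norm (u \<epsilon> x - (\<Sum>i<Suc n. \<epsilon> ^ i *\<^sub>R e i x)) \<le> C * \<epsilon> ^ Suc n"
      if \<epsilon>: "0 < \<epsilon>" "\<epsilon> < min b d" and x: "x \<in> S" for \<epsilon> x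
    proof -
      define w where "w s = u s x - (\<Sum>i<n. (s ^ Suc i / (real i + 1)) *\<^sub>R c i x)" for s
      have w': "(w has_vector_derivative u' s x - (\<Sum>i<n. s ^ i *\<^sub>R c i x)) (at s)"
        if "-d < s" "s < d" for s
      proof -
        have "((\<lambda>s::real. s ^ Suc i / (real i + 1)) has_real_derivative s ^ i) (at s)" for i
        proof -
          have "((\<lambda>s::real. s ^ Suc i / (real i + 1)) has_real_derivative
              (real (Suc i) * s ^ i) / (real i + 1)) (at s)"
            by (rule DERIV_cdivide) (use DERIV_pow[of "Suc i" s] in simp)
          moreover have "(real (Suc i) * s ^ i) / (real i + 1) = s ^ i"
            by (simp add: field_simps)
          ultimately show ?thesis by simp
        qed
        then have "((\<lambda>s::real. (s ^ Suc i / (real i + 1)) *\<^sub>R c i x) has_vector_derivative s ^ i *\<^sub>R c i x) (at s)" for i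
          using has_vector_derivative_scaleR[OF _ has_vector_derivative_const] by fastforce
        then show ?thesis unfolding w_def
          by (intro has_vector_derivative_diff deriv[OF x that] has_vector_derivative_sum) auto
      qed
      have "\<exists>s\<in>{0<..<\<epsilon>}. norm (w \<epsilon> - w 0)
          \<le> norm ((\<epsilon> - 0) *\<^sub>R (u' s x - (\<Sum>i<n. s ^ i *\<^sub>R c i x)))"
      proof (rule mvt_general[OF \<epsilon>(1)])
        show "continuous_on {0..\<epsilon>} w"
        proof (intro continuous_at_imp_continuous_on ballI)
          fix s assume "s \<in> {0..\<epsilon>}"
          then show "isCont w s" using \<epsilon> d by (intro has_vector_derivative_continuous[OF w']) auto
        qed
        fix s assume "0 < s" "s < \<epsilon>"
        then have "(w has_vector_derivative u' s x - (\<Sum>i<n. s ^ i *\<^sub>R c i x)) (at s)"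
          using \<epsilon> d by (intro w') auto
        then show "(w has_derivative (\<lambda>r. r *\<^sub>R (u' s x - (\<Sum>i<n. s ^ i *\<^sub>R c i x)))) (at s)"
          by (simp add: has_vector_derivative_def)
      qed
      then obtain s where s: "0 < s" "s < \<epsilon>" and le: "norm (w \<epsilon> - w 0)
          \<le> \<epsilon> * norm (u' s x - (\<Sum>i<n. s ^ i *\<^sub>R c i x))"
        using \<epsilon> by auto
      note le
      also have "\<dots> \<le> \<epsilon> * (C * \<epsilon> ^ n)"
      proof -
        have "norm (u' s x - (\<Sum>i<n. s ^ i *\<^sub>R c i x)) \<le> C * s ^ n" using C s \<epsilon> x by simp
        also have "\<dots> \<le> C * \<epsilon> ^ n" using s C0 by (intro mult_left_mono power_mono) auto
        finally show ?thesis using \<epsilon> by simp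
      qed
      finally have "norm (w \<epsilon> - w 0) \<le> C * \<epsilon> ^ Suc n" by (simp add: mult_ac)
      moreover have "w \<epsilon> - w 0 = u \<epsilon> x - (\<Sum>i<Suc n. \<epsilon> ^ i *\<^sub>R e i x)"
        by (simp add: w_def e_def sum.lessThan_Suc_shift algebra_simps del: sum.lessThan_Suc)
      ultimately show ?thesis by simp
    qed
    then show "\<forall>\<^sub>F \<epsilon> in at_right 0. \<forall>x\<in>S. norm (u \<epsilon> x - (\<Sum>i<Suc n. \<epsilon> ^ i *\<^sub>R e i x)) \<le> C * \<epsilon> ^ Suc n"
      using eventually_at_right_0_less[of "min b d"] b d by (auto elim!: eventually_mono)
    show "continuous_on S (e i)" if "i < Suc n" for i
      using that c(1) cont by (auto simp: e_def split: nat.split intro!: continuous_on_scaleR)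
  qed (use bd in blast)
qed

section \<open>Composition of an expansion with a smooth function\<close>

definition slab :: "real \<Rightarrow> ('x::real_normed_vector \<times> 'y::real_normed_vector \<times> real) set" where
  "slab d = UNIV \<times> UNIV \<times> {-d<..<d}"

lemma open_slab: "open (slab d)"
  unfolding slab_def by (intro open_Times open_UNIV open_greaterThanLessThan)

lemma slab_iff [simp]: "(x, y, s) \<in> slab d \<longleftrightarrow> -d < s \<and> s < d"
  by (auto simp: slab_def)

lemma bounded_image_inner:
  fixes V :: "'a \<Rightarrow> 'b::real_inner"
  assumes "bounded (V ` S)"
  shows "bounded ((\<lambda>x. V x \<bullet> b) ` S)"
  using bounded_linear_image[OF assms bounded_linear_inner_left[of b]] by (simp add: image_image)

lemma bounded_polynomial_image:
  fixes c :: "nat \<Rightarrow> 'a \<Rightarrow> 'b::real_normed_vector"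
  assumes "\<And>i. i < N \<Longrightarrow> bounded (c i ` S)"
  obtains B where "\<And>s x. \<lbrakk>0 \<le> s; s \<le> 1; x \<in> S\<rbrakk> \<Longrightarrow> norm (\<Sum>i<N. s ^ i *\<^sub>R c i x) \<le> B"
proof -
  have "\<exists>B. \<forall>x\<in>S. norm (c i x) \<le> B" if "i < N" for i
    using assms[OF that] by (auto simp: bounded_iff)
  then obtain B where B: "\<And>i x. i < N \<Longrightarrow> x \<in> S \<Longrightarrow> norm (c i x) \<le> B i" by metis
  show thesis
  proof (rule that[of "\<Sum>i<N. B i"])
    fix s :: real and x assume s: "0 \<le> s" "s \<le> 1" and x: "x \<in> S"
    have "norm (s ^ i *\<^sub>R c i x) \<le> B i" if "i < N" for i
    proof -
      have "\<bar>s ^ i\<bar> * norm (c i x) \<le> 1 * B i"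
        using B[OF that x] s by (intro mult_mono) (auto simp: power_le_one)
      then show ?thesis by simp
    qed
    then show "norm (\<Sum>i<N. s ^ i *\<^sub>R c i x) \<le> (\<Sum>i<N. B i)"
      by (intro sum_norm_le) auto
  qed
qed

text \<open>
  Along the polynomial curves \<open>s \<mapsto> (x, \<Sum>i<N. s^i c\<^sub>i(x), s)\<close> the \<open>s\<close>-derivative of \<open>p\<close> is a
  combination of directional derivatives of \<open>p\<close> along the same curves, with coefficients that are
  powers of \<open>s\<close>. Since these have one order of smoothness less, induction on \<open>n\<close> gives their
  expansions, and integration in \<open>s\<close> that of \<open>p\<close>.
\<close>

lemma expandable_compose_polynomial:
  fixes p :: "'x::euclidean_space \<times> 'y::euclidean_space \<times> real \<Rightarrow> 'z::euclidean_space"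
  assumes d: "d > 0" and S: "bounded S"
    and c: "\<And>i. i < N \<Longrightarrow> continuous_on S (c i)" "\<And>i. i < N \<Longrightarrow> bounded (c i ` S)"
  shows "Ck_on n p (slab d) \<Longrightarrow> expandable n S (\<lambda>s x. p (x, \<Sum>i<N. s ^ i *\<^sub>R c i x, s))"
proof (induction n arbitrary: p)
  obtain A where A: "\<And>x. x \<in> S \<Longrightarrow> norm x \<le> A" using S by (auto simp: bounded_iff)
  obtain B where B: "\<And>s x. \<lbrakk>0 \<le> s; s \<le> 1; x \<in> S\<rbrakk> \<Longrightarrow> norm (\<Sum>i<N. s ^ i *\<^sub>R c i x) \<le> B"
    using bounded_polynomial_image c(2) by blast
  have bound: "\<exists>M. \<forall>x\<in>S. \<forall>s. 0 \<le> s \<and> s \<le> min 1 (d/2) \<longrightarrow> norm (p (x, \<Sum>i<N. s ^ i *\<^sub>R c i x, s)) \<le> M"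
    if "continuous_on (slab d) p" for p :: "'x \<times> 'y \<times> real \<Rightarrow> 'z"
  proof -
    define T :: "('x \<times> 'y \<times> real) set" where "T = cball 0 A \<times> cball 0 B \<times> {0..min 1 (d/2)}"
    have "compact T" unfolding T_def by (intro compact_Times compact_cball compact_Icc)
    moreover have "continuous_on T p"
      using that by (rule continuous_on_subset) (use d in \<open>auto simp: T_def\<close>)
    ultimately have "bounded (p ` T)" by (simp add: compact_continuous_image compact_imp_bounded)
    then obtain M where M: "\<And>z. z \<in> T \<Longrightarrow> norm (p z) \<le> M" by (auto simp: bounded_iff)
    have "(x, \<Sum>i<N. s ^ i *\<^sub>R c i x, s) \<in> T" if "x \<in> S" "0 \<le> s" "s \<le> min 1 (d/2)" for x s
      using A[of x] B[of s x] that by (simp add: T_def)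
    then show ?thesis using M by blast
  qed
  {
    case 0
    from bound[of p] obtain M where M: "\<And>x s. \<lbrakk>x\<in>S; 0 \<le> s; s \<le> min 1 (d/2)\<rbrakk> \<Longrightarrow> norm (p (x, \<Sum>i<N. s ^ i *\<^sub>R c i x, s)) \<le> M"
      using Ck_on_imp_continuous_on[OF 0] by metis
    show ?case
      by (rule expandableI[where c = "\<lambda>_ _. 0" and C = M])
        (use eventually_at_right_0_less[of "min 1 (d/2)"] d M in \<open>auto elim!: eventually_mono\<close>)
  next
    case (Suc n)
    let ?\<gamma> = "\<lambda>s x. (x, \<Sum>i<N. s ^ i *\<^sub>R c i x, s)"
    let ?D = "\<lambda>z. frechet_derivative p (at z)"
    define P' where "P' s x = (\<Sum>i<N. (real i * s ^ (i - 1)) *\<^sub>R c i x)" for s x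
    have diff: "(p has_derivative ?D z) (at z)" if "z \<in> slab d" for z
      using Ck_on_Suc_has_derivative[OF Suc.prems that] .
    have dir: "expandable n S (\<lambda>s x. ?D (?\<gamma> s x) (V x))"
      if V: "continuous_on S V" "bounded (V ` S)" for V
    proof (rule expandable_cong)
      have "expandable n S (\<lambda>s x. ?D (?\<gamma> s x) b)" for b
        by (rule Suc.IH[OF Ck_on_frechet_derivative[OF Suc.prems]])
      then show "expandable n S (\<lambda>s x. \<Sum>b\<in>Basis. (V x \<bullet> b) *\<^sub>R ?D (?\<gamma> s x) b)"
        using V by (auto intro!: expandable_sum expandable_scale continuous_on_inner continuous_on_const bounded_image_inner)
      show "\<forall>\<^sub>F s in at_right 0. \<forall>x\<in>S. ?D (?\<gamma> s x) (V x) = (\<Sum>b\<in>Basis. (V x \<bullet> b) *\<^sub>R ?D (?\<gamma> s x) b)"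
        using eventually_at_right_0_less[OF d]
      proof eventually_elim
        case (elim s)
        show ?case
        proof
          fix x
          show "?D (?\<gamma> s x) (V x) = (\<Sum>b\<in>Basis. (V x \<bullet> b) *\<^sub>R ?D (?\<gamma> s x) b)"
            by (rule frechet_derivative_apply_Basis) (use diff[of "?\<gamma> s x"] elim in \<open>auto simp: differentiable_def\<close>)
        qed
      qed
    qed
    show ?case
    proof (rule expandable_integrate[OF _ d, where u' = "\<lambda>s x. ?D (?\<gamma> s x) (0, P' s x, 1)"])
      show "expandable n S (\<lambda>s x. ?D (?\<gamma> s x) (0, P' s x, 1))"
      proof (rule expandable_cong)
        have "bounded ((\<lambda>x. (0::'x, c i x, 0::real)) ` S)" if "i < N" for i
        proof -
          have "bounded_linear (\<lambda>y::'y. (0::'x, y, 0::real))"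
            by (intro bounded_linear_Pair bounded_linear_zero bounded_linear_ident)
          from bounded_linear_image[OF c(2)[OF that] this] show ?thesis by (simp add: image_image)
        qed
        then have "expandable n S (\<lambda>s x. ?D (?\<gamma> s x) (0, c i x, 0))" if "i < N" for i
          using that c(1) by (intro dir) (auto intro!: continuous_on_Pair)
        from expandable_eps_power[OF this] have
          "expandable n S (\<lambda>s x. real i *\<^sub>R s ^ (i - 1) *\<^sub>R ?D (?\<gamma> s x) (0, c i x, 0))" if "i < N" for i
          using that by (intro expandable_scale[OF _ continuous_on_const]) (auto simp: image_constant_conv)
        moreover have "expandable n S (\<lambda>s x. ?D (?\<gamma> s x) (0, 0, 1))"
          by (rule dir) (auto simp: image_constant_conv)
        ultimately show "expandable n S (\<lambda>s x. (\<Sum>i<N. real i *\<^sub>R s ^ (i - 1) *\<^sub>R ?D (?\<gamma> s x) (0, c i x, 0))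
            + ?D (?\<gamma> s x) (0, 0, 1))"
          by (intro expandable_add expandable_sum) auto
        show "\<forall>\<^sub>F s in at_right 0. \<forall>x\<in>S. ?D (?\<gamma> s x) (0, P' s x, 1)
           = (\<Sum>i<N. real i *\<^sub>R s ^ (i - 1) *\<^sub>R ?D (?\<gamma> s x) (0, c i x, 0)) + ?D (?\<gamma> s x) (0, 0, 1)"
          using eventually_at_right_0_less[OF d]
        proof eventually_elim
          case (elim s)
          show ?case
          proof
            fix x
            have lin: "linear (?D (?\<gamma> s x))"
              using diff[of "?\<gamma> s x"] elim by (auto intro: has_derivative_linear)
            have "(0, P' s x, 1) = (\<Sum>i<N. (real i * s ^ (i - 1)) *\<^sub>R (0::'x, c i x, 0::real)) + (0, 0, 1)"
              by (simp add: P'_def sum_prod prod_eq_iff fst_sum snd_sum)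
            then show "?D (?\<gamma> s x) (0, P' s x, 1)
              = (\<Sum>i<N. real i *\<^sub>R s ^ (i - 1) *\<^sub>R ?D (?\<gamma> s x) (0, c i x, 0)) + ?D (?\<gamma> s x) (0, 0, 1)"
              by (simp only: linear_add[OF lin] linear_sum[OF lin] linear_scale[OF lin] scaleR_scaleR)
          qed
        qed
      qed
      show "((\<lambda>s. p (?\<gamma> s x)) has_vector_derivative ?D (?\<gamma> s x) (0, P' s x, 1)) (at s)"
        if "x \<in> S" "-d < s" "s < d" for s x
      proof -
        have "((\<lambda>s. s ^ i *\<^sub>R c i x) has_vector_derivative (real i * s ^ (i - 1)) *\<^sub>R c i x) (at s)" for i
          using has_vector_derivative_scaleR[OF DERIV_pow[of i s UNIV] has_vector_derivative_const[of "c i x"]] by simp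
        then have "((\<lambda>s. ?\<gamma> s x) has_vector_derivative (0, P' s x, 1)) (at s)"
          unfolding P'_def
          by (intro has_vector_derivative_Pair has_vector_derivative_const has_vector_derivative_sum has_vector_derivative_id) auto
        moreover have "(p has_derivative ?D (?\<gamma> s x)) (at (?\<gamma> s x))"
          using that by (intro diff) auto
        from vector_derivative_diff_chain_within[OF calculation has_derivative_at_withinI[OF this]]
        show ?thesis by (simp add: o_def)
      qed
      show "continuous_on S (\<lambda>x. p (?\<gamma> 0 x))"
        by (rule continuous_on_compose2[OF Ck_on_imp_continuous_on[OF Suc.prems]])
          (use c(1) d in \<open>auto intro!: continuous_intros\<close>)
      show "bounded ((\<lambda>x. p (?\<gamma> 0 x)) ` S)"
      proof -
        obtain M where "\<forall>x\<in>S. \<forall>s. 0 \<le> s \<and> s \<le> min 1 (d/2) \<longrightarrow> norm (p (?\<gamma> s x)) \<le> M"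
          using bound[OF Ck_on_imp_continuous_on[OF Suc.prems]] by blast
        then have "\<forall>x\<in>S. norm (p (?\<gamma> 0 x)) \<le> M" using d by simp
        then show ?thesis unfolding bounded_iff by blast
      qed
    qed
  }
qed

text \<open>
  Replacing the argument by its truncated expansion costs only \<open>O(\<epsilon>^n)\<close>, because \<open>p\<close> is Lipschitz
  on a compact convex set containing all the points involved.
\<close>

lemma expandable_compose:
  fixes p :: "'x::euclidean_space \<times> 'y::euclidean_space \<times> real \<Rightarrow> 'z::euclidean_space"
  assumes d: "d > 0" and S: "bounded S" and n: "n > 0"
    and h: "expandable n S h"
    and p: "Ck_on n p (slab d)"
  shows "expandable n S (\<lambda>\<epsilon> x. p (x, h \<epsilon> x, \<epsilon>))"
proof -
  obtain C c where C0: "C \<ge> 0"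
    and c: "\<forall>i<n. continuous_on S (c i)" "\<forall>i<n. bounded (c i ` S)"
    and C: "\<forall>\<^sub>F \<epsilon> in at_right 0. \<forall>x\<in>S. norm (h \<epsilon> x - (\<Sum>i<n. \<epsilon> ^ i *\<^sub>R c i x)) \<le> C * \<epsilon> ^ n"
    by (rule expandableE[OF h])
  note c = c[rule_format]
  obtain A where A: "\<And>x. x \<in> S \<Longrightarrow> norm x \<le> A" using S by (auto simp: bounded_iff)
  obtain B where B: "\<And>s x. \<lbrakk>0 \<le> s; s \<le> 1; x \<in> S\<rbrakk> \<Longrightarrow> norm (\<Sum>i<n. s ^ i *\<^sub>R c i x) \<le> B"
    using bounded_polynomial_image c(2) by blast
  define T :: "('x \<times> 'y \<times> real) set" where "T = cball 0 A \<times> cball 0 (B + C) \<times> {0..d/2}"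
  have T: "compact T" "convex T"
    unfolding T_def by (intro compact_Times compact_cball compact_Icc convex_Times convex_cball convex_real_interval)+
  have Ts: "T \<subseteq> slab d" using d by (auto simp: T_def)
  have p1: "Ck_on (Suc 0) p (slab d)" using Ck_on_mono[OF _ p, of "Suc 0"] n by simp
  obtain M where M: "M \<ge> 0" "\<And>z v. z \<in> T \<Longrightarrow> norm (frechet_derivative p (at z) v) \<le> M * norm v"
    using frechet_derivative_bounded_on_compact[OF p1 T(1) Ts] by blast
  have lip: "norm (p z - p z') \<le> M * norm (z - z')" if "z \<in> T" "z' \<in> T" for z z'
  proof (rule differentiable_bound[OF T(2) _ _ that])
    fix w assume w: "w \<in> T"
    then show "(p has_derivative frechet_derivative p (at w)) (at w within T)"
      using Ck_on_Suc_has_derivative[OF p1] Ts has_derivative_at_withinI by blast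
    show "onorm (frechet_derivative p (at w)) \<le> M"
      using M w by (intro onorm_bound) auto
  qed
  have d2: "0 < min 1 (d/2)" using d by simp
  show ?thesis
  proof (rule expandable_perturb[OF expandable_compose_polynomial[OF d S c p]])
    show "\<forall>\<^sub>F \<epsilon> in at_right 0. \<forall>x\<in>S. norm (p (x, h \<epsilon> x, \<epsilon>) - p (x, \<Sum>i<n. \<epsilon> ^ i *\<^sub>R c i x, \<epsilon>))
        \<le> (M * C) * \<epsilon> ^ n"
      using C eventually_at_right_0_less[OF d2]
    proof eventually_elim
      case (elim \<epsilon>)
      then have \<epsilon>: "0 < \<epsilon>" "\<epsilon> < 1" "\<epsilon> < d/2" using d by auto
      show ?case
      proof
        fix x assume x: "x \<in> S"
        let ?P = "\<Sum>i<n. \<epsilon> ^ i *\<^sub>R c i x"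
        have 1: "norm (h \<epsilon> x - ?P) \<le> C * \<epsilon> ^ n" using elim x by blast
        also have "\<dots> \<le> C * 1" using \<epsilon> C0 by (intro mult_left_mono power_le_one) auto
        finally have "norm (h \<epsilon> x - ?P) \<le> C" by simp
        moreover have P: "norm ?P \<le> B" using B[of \<epsilon> x] \<epsilon> x by simp
        ultimately have "norm (h \<epsilon> x) \<le> B + C"
          using norm_triangle_sub[of "h \<epsilon> x" ?P] by linarith
        then have "(x, h \<epsilon> x, \<epsilon>) \<in> T" "(x, ?P, \<epsilon>) \<in> T"
          using A[OF x] \<epsilon> P C0 by (auto simp: T_def)
        from lip[OF this] have "norm (p (x, h \<epsilon> x, \<epsilon>) - p (x, ?P, \<epsilon>)) \<le> M * norm (h \<epsilon> x - ?P)"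
          by (simp add: norm_Pair)
        also have "\<dots> \<le> M * (C * \<epsilon> ^ n)" using 1 M(1) by (rule mult_left_mono)
        finally show "norm (p (x, h \<epsilon> x, \<epsilon>) - p (x, ?P, \<epsilon>)) \<le> (M * C) * \<epsilon> ^ n"
          by (simp add: mult.assoc)
      qed
    qed
  qed
qed

section \<open>Orders of magnitude along the slow motion\<close>

text \<open>
  Subtracting the paraboloid \<open>A (dist x a)\<^sup>2\<close>, with \<open>A\<close> just large enough that the values on the
  sphere drop below the value at the centre, forces a maximum in the open ball. There the
  derivative of \<open>w\<close> equals that of the paraboloid.
\<close>

lemma exists_small_derivative:
  fixes w :: "'a::euclidean_space \<Rightarrow> real"
  assumes r: "r > 0" and bound: "\<And>x. x \<in> cball a r \<Longrightarrow> \<bar>w x\<bar> \<le> M"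
    and deriv: "\<And>x. x \<in> cball a r \<Longrightarrow> (w has_derivative w' x) (at x)"
  shows "\<exists>x\<in>ball a r. \<forall>v. \<bar>w' x v\<bar> \<le> 2 * (2 * M + 1) / r * norm v"
proof -
  define A where "A = (2 * M + 1) / r\<^sup>2"
  define \<psi> where "\<psi> x = w x - A * ((x - a) \<bullet> (x - a))" for x
  have M: "M \<ge> 0" using bound[of a] r by simp
  then have A: "A \<ge> 0" by (simp add: A_def)
  have d\<psi>: "(\<psi> has_derivative (\<lambda>v. w' x v - A * (2 * ((x - a) \<bullet> v)))) (at x)" if "x \<in> cball a r" for x
    unfolding \<psi>_def
    by (rule derivative_eq_intros deriv[OF that] | simp add: inner_commute)+
  then have "continuous_on (cball a r) \<psi>"
    by (intro continuous_at_imp_continuous_on ballI) (metis has_derivative_continuous)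
  then obtain x where x: "x \<in> cball a r" and max: "\<And>y. y \<in> cball a r \<Longrightarrow> \<psi> y \<le> \<psi> x"
    using continuous_attains_sup[of "cball a r" \<psi>] r by auto
  have "dist a x \<noteq> r"
  proof
    assume "dist a x = r"
    then have "(x - a) \<bullet> (x - a) = r\<^sup>2"
      by (simp add: dist_norm norm_minus_commute power2_norm_eq_inner[symmetric])
    then have "\<psi> x = w x - (2 * M + 1)" using r by (simp add: \<psi>_def A_def)
    also have "\<dots> < - M" using bound[OF x] by simp
    also have "\<dots> \<le> \<psi> a" using bound[of a] r by (simp add: \<psi>_def)
    finally show False using max[of a] r by simp
  qed
  with x have xb: "x \<in> ball a r" by simp
  have "(\<lambda>v. w' x v - A * (2 * ((x - a) \<bullet> v))) = (\<lambda>v. 0)"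
    by (rule differential_zero_maxmin[OF xb open_ball d\<psi>[OF x]]) (use max in auto)
  then have w': "w' x v = 2 * A * ((x - a) \<bullet> v)" for v by (auto dest: fun_cong[of _ _ v])
  have "\<bar>w' x v\<bar> \<le> 2 * (2 * M + 1) / r * norm v" for v
  proof -
    have "\<bar>w' x v\<bar> = 2 * A * \<bar>(x - a) \<bullet> v\<bar>" using A by (simp add: w' abs_mult)
    also have "\<dots> \<le> 2 * A * (r * norm v)"
    proof -
      have "\<bar>(x - a) \<bullet> v\<bar> \<le> norm (x - a) * norm v" by (rule Cauchy_Schwarz_ineq2)
      also have "\<dots> \<le> r * norm v"
        using x by (intro mult_right_mono) (auto simp: dist_norm norm_minus_commute)
      finally show ?thesis using A by (intro mult_left_mono) auto
    qed
    also have "\<dots> = 2 * (2 * M + 1) / r * norm v"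
      using r by (simp add: A_def power2_eq_square)
    finally show ?thesis .
  qed
  with xb show ?thesis by blast
qed

lemma expansion_truncate:
  assumes c: "\<And>i. i < n \<Longrightarrow> bounded (c i ` S)"
    and rem: "\<forall>\<^sub>F \<epsilon> in at_right 0. \<forall>x\<in>S. norm (u \<epsilon> x - (\<Sum>i<n. \<epsilon> ^ i *\<^sub>R c i x)) \<le> C * \<epsilon> ^ n"
    and j: "j \<le> n"
  shows "\<exists>C. \<forall>\<^sub>F \<epsilon> in at_right 0. \<forall>x\<in>S. norm (u \<epsilon> x - (\<Sum>i<j. \<epsilon> ^ i *\<^sub>R c i x)) \<le> C * \<epsilon> ^ j"
  using j
proof (induction j rule: inc_induct)
  case base
  then show ?case using rem by blast
next
  case (step j)
  obtain D where D: "\<forall>\<^sub>F \<epsilon> in at_right 0. \<forall>x\<in>S.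
      norm (u \<epsilon> x - (\<Sum>i<Suc j. \<epsilon> ^ i *\<^sub>R c i x)) \<le> D * \<epsilon> ^ Suc j"
    using step.IH by blast
  obtain B where B: "\<And>x. x \<in> S \<Longrightarrow> norm (c j x) \<le> B" using c[of j] step.hyps by (auto simp: bounded_iff)
  have "\<forall>\<^sub>F \<epsilon> in at_right 0. \<forall>x\<in>S. norm (u \<epsilon> x - (\<Sum>i<j. \<epsilon> ^ i *\<^sub>R c i x)) \<le> (\<bar>D\<bar> + B) * \<epsilon> ^ j"
    using D eventually_at_right_0_less[OF zero_less_one]
  proof eventually_elim
    case (elim \<epsilon>)
    show ?case
    proof
      fix x assume x: "x \<in> S"
      have "norm (u \<epsilon> x - (\<Sum>i<Suc j. \<epsilon> ^ i *\<^sub>R c i x)) \<le> D * \<epsilon> ^ Suc j" using elim x by blast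
      also have "\<dots> \<le> \<bar>D\<bar> * \<epsilon> ^ j"
        using elim by (intro mult_mono power_decreasing) auto
      finally have "norm (u \<epsilon> x - (\<Sum>i<Suc j. \<epsilon> ^ i *\<^sub>R c i x)) \<le> \<bar>D\<bar> * \<epsilon> ^ j" .
      moreover have "norm (\<epsilon> ^ j *\<^sub>R c j x) \<le> \<epsilon> ^ j * B" using elim B[OF x] by simp
      ultimately have "norm (u \<epsilon> x - (\<Sum>i<Suc j. \<epsilon> ^ i *\<^sub>R c i x) + \<epsilon> ^ j *\<^sub>R c j x)
          \<le> \<bar>D\<bar> * \<epsilon> ^ j + \<epsilon> ^ j * B" by (rule norm_triangle_mono)
      then show "norm (u \<epsilon> x - (\<Sum>i<j. \<epsilon> ^ i *\<^sub>R c i x)) \<le> (\<bar>D\<bar> + B) * \<epsilon> ^ j"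
        by (simp add: algebra_simps)
    qed
  qed
  then show ?case by blast
qed

text \<open>
  Here \<open>u\<close> and \<open>v = \<epsilon> Du a\<close> stand for consecutive scaled time derivatives on the slow manifold, with
  \<open>a\<close> the slow velocity. No bound on \<open>Du\<close> is available; instead every coefficient of
  \<open>v\<close> of order at most \<open>k\<close> vanishes. Suppose the coefficient \<open>c\<^sub>j\<close> is the first nonzero one, and
  \<open>j \<le> k\<close>. Then \<open>v\<close> has, in the direction \<open>e\<close> of \<open>c\<^sub>j\<close> at an interior point, a component of size
  at least a multiple of \<open>\<epsilon>^j\<close> on a ball. At the point of the ball where the
  gradient of the bounded function \<open>e \<bullet> u / \<epsilon>^k\<close> is under control, however, that component of \<open>v\<close>
  is at most a multiple of \<open>\<epsilon>^(k+1)\<close>.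
\<close>

lemma slow_derivative_order:
  fixes u v :: "real \<Rightarrow> 'a::euclidean_space \<Rightarrow> 'b::euclidean_space"
    and a :: "real \<Rightarrow> 'a \<Rightarrow> 'a"
  assumes v: "expandable n S v" and k: "k < n" and S: "S \<subseteq> closure (interior S)"
    and u: "\<forall>\<^sub>F \<epsilon> in at_right 0. \<forall>x\<in>S. norm (u \<epsilon> x) \<le> C * \<epsilon> ^ k"
    and a: "\<forall>\<^sub>F \<epsilon> in at_right 0. \<forall>x\<in>S. norm (a \<epsilon> x) \<le> A"
    and deriv: "\<forall>\<^sub>F \<epsilon> in at_right 0. \<forall>x\<in>interior S.
      (u \<epsilon> has_derivative u' \<epsilon> x) (at x) \<and> v \<epsilon> x = \<epsilon> *\<^sub>R u' \<epsilon> x (a \<epsilon> x)"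
  shows "\<exists>C. \<forall>\<^sub>F \<epsilon> in at_right 0. \<forall>x\<in>S. norm (v \<epsilon> x) \<le> C * \<epsilon> ^ Suc k"
proof -
  obtain D c where D0: "D \<ge> 0"
    and c: "\<forall>i<n. continuous_on S (c i)" "\<forall>i<n. bounded (c i ` S)"
    and D: "\<forall>\<^sub>F \<epsilon> in at_right 0. \<forall>x\<in>S. norm (v \<epsilon> x - (\<Sum>i<n. \<epsilon> ^ i *\<^sub>R c i x)) \<le> D * \<epsilon> ^ n"
    by (rule expandableE[OF v])
  note c = c[rule_format]
  have trunc: "\<exists>C. \<forall>\<^sub>F \<epsilon> in at_right 0. \<forall>x\<in>S. norm (v \<epsilon> x - (\<Sum>i<j. \<epsilon> ^ i *\<^sub>R c i x)) \<le> C * \<epsilon> ^ j"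
    if "j \<le> n" for j
    using expansion_truncate[OF c(2) D that] .
  \<comment> \<open>On the interior the coefficients vanish by contradiction, on the rest of \<open>S\<close> by continuity.\<close>
  have zero: "\<forall>x\<in>S. c j x = 0" if "j \<le> k" for j
    using that
  proof (induction j rule: less_induct)
    case (less j)
    have j: "j < n" using less.prems k by simp
    obtain E where E: "\<forall>\<^sub>F \<epsilon> in at_right 0. \<forall>x\<in>S. norm (v \<epsilon> x - (\<Sum>i<Suc j. \<epsilon> ^ i *\<^sub>R c i x)) \<le> E * \<epsilon> ^ Suc j"
      using trunc[of "Suc j"] j by auto
    have int: "c j b = 0" if b: "b \<in> interior S" for b
    proof (rule ccontr)
      assume nz: "c j b \<noteq> 0"
      define e where "e = c j b"
      define \<gamma> where "\<gamma> = e \<bullet> e"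
      have \<gamma>: "\<gamma> > 0" using nz by (simp add: \<gamma>_def e_def)
      define U where "U = interior S \<inter> (\<lambda>x. e \<bullet> c j x) -` {\<gamma>/2<..}"
      have "continuous_on (interior S) (\<lambda>x. e \<bullet> c j x)"
        using continuous_on_subset[OF c(1)[OF j] interior_subset] by (intro continuous_on_inner continuous_on_const)
      then have "open U" unfolding U_def by (intro continuous_open_preimage) auto
      moreover have "b \<in> U" using b \<gamma> by (simp add: U_def \<gamma>_def e_def)
      ultimately obtain r where r: "r > 0" "cball b r \<subseteq> U" using open_contains_cball by blast
      define M where "M = norm e * \<bar>C\<bar>"
      define G where "G = 2 * (2 * M + 1) / r * \<bar>A\<bar>"
      have M: "M \<ge> 0" by (simp add: M_def)
      have G: "G \<ge> 0" using M r by (simp add: G_def)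
      define Q where "Q = norm e * \<bar>E\<bar> + G"
      have Q: "Q \<ge> 0" using G by (simp add: Q_def)
      have pos: "0 < min 1 (\<gamma> / (2 * (Q + 1)))" using \<gamma> Q by simp
      \<comment> \<open>All requirements hold for small \<open>\<epsilon>\<close>; a single such \<open>\<epsilon>\<close> already gives the contradiction.\<close>
      have "\<forall>\<^sub>F \<epsilon> in at_right (0::real). False"
        using E u a deriv eventually_at_right_0_less[OF pos]
      proof eventually_elim
        case (elim \<epsilon>)
        then have \<epsilon>: "0 < \<epsilon>" "\<epsilon> < 1" "\<epsilon> < \<gamma> / (2 * (Q + 1))" by auto
        define w where "w x = (e \<bullet> u \<epsilon> x) / \<epsilon> ^ k" for x
        have cb: "x \<in> interior S" "x \<in> S" "e \<bullet> c j x > \<gamma>/2" if "x \<in> cball b r" for x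
          using that r(2) interior_subset[of S] by (auto simp: U_def)
        have "\<exists>x\<in>ball b r. \<forall>y. \<bar>(e \<bullet> u' \<epsilon> x y) / \<epsilon> ^ k\<bar> \<le> 2 * (2 * M + 1) / r * norm y"
        proof (rule exists_small_derivative[OF r(1)])
          fix x assume x: "x \<in> cball b r"
          have "\<bar>e \<bullet> u \<epsilon> x\<bar> \<le> norm e * norm (u \<epsilon> x)" by (rule Cauchy_Schwarz_ineq2)
          also have "\<dots> \<le> norm e * (\<bar>C\<bar> * \<epsilon> ^ k)"
          proof (rule mult_left_mono)
            have "norm (u \<epsilon> x) \<le> C * \<epsilon> ^ k" using elim(2) cb(2)[OF x] by blast
            also have "\<dots> \<le> \<bar>C\<bar> * \<epsilon> ^ k" using \<epsilon> by (intro mult_right_mono) auto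
            finally show "norm (u \<epsilon> x) \<le> \<bar>C\<bar> * \<epsilon> ^ k" .
          qed simp
          finally show "\<bar>w x\<bar> \<le> M" using \<epsilon> by (simp add: w_def M_def field_simps)
          have "(u \<epsilon> has_derivative u' \<epsilon> x) (at x)" using elim(4) cb(1)[OF x] by blast
          then show "(w has_derivative (\<lambda>y. (e \<bullet> u' \<epsilon> x y) / \<epsilon> ^ k)) (at x)"
            unfolding w_def
            by (intro bounded_linear.has_derivative[OF bounded_linear_divide]
                bounded_linear.has_derivative[OF bounded_linear_inner_right])
        qed
        then obtain x where xb: "x \<in> ball b r"
          and small: "\<And>y. \<bar>(e \<bullet> u' \<epsilon> x y) / \<epsilon> ^ k\<bar> \<le> 2 * (2 * M + 1) / r * norm y" by blast
        then have x: "x \<in> interior S" "x \<in> S" "e \<bullet> c j x > \<gamma>/2" using cb[of x] by auto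
        have "norm (a \<epsilon> x) \<le> \<bar>A\<bar>" using elim(3) x(2) by fastforce
        then have "2 * (2 * M + 1) / r * norm (a \<epsilon> x) \<le> G"
          unfolding G_def using M r by (intro mult_left_mono) auto
        with small[of "a \<epsilon> x"] have "\<bar>(e \<bullet> u' \<epsilon> x (a \<epsilon> x)) / \<epsilon> ^ k\<bar> \<le> G" by linarith
        then have "e \<bullet> u' \<epsilon> x (a \<epsilon> x) \<le> G * \<epsilon> ^ k" using \<epsilon> by (auto simp: field_simps abs_le_iff)
        moreover have "e \<bullet> v \<epsilon> x = \<epsilon> * (e \<bullet> u' \<epsilon> x (a \<epsilon> x))" using elim(4) x(1) by simp
        ultimately have "e \<bullet> v \<epsilon> x \<le> \<epsilon> * (G * \<epsilon> ^ k)" using \<epsilon> by simp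
        also have "\<dots> = G * \<epsilon> ^ Suc k" by simp
        also have "\<dots> \<le> G * \<epsilon> ^ Suc j"
          using \<epsilon> G less.prems by (intro mult_left_mono power_decreasing) auto
        finally have up: "e \<bullet> v \<epsilon> x \<le> G * \<epsilon> ^ Suc j" .
        have "(\<Sum>i<Suc j. \<epsilon> ^ i *\<^sub>R c i x) = \<epsilon> ^ j *\<^sub>R c j x"
          using less.IH less.prems x(2) by simp
        then have "norm (v \<epsilon> x - \<epsilon> ^ j *\<^sub>R c j x) \<le> E * \<epsilon> ^ Suc j" using elim(1) x(2) by metis
        also have "\<dots> \<le> \<bar>E\<bar> * \<epsilon> ^ Suc j" using \<epsilon> by (intro mult_right_mono) auto
        finally have "norm e * norm (v \<epsilon> x - \<epsilon> ^ j *\<^sub>R c j x) \<le> norm e * (\<bar>E\<bar> * \<epsilon> ^ Suc j)"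
          by (rule mult_left_mono) simp
        with Cauchy_Schwarz_ineq2[of e "v \<epsilon> x - \<epsilon> ^ j *\<^sub>R c j x"]
        have "\<bar>e \<bullet> v \<epsilon> x - \<epsilon> ^ j * (e \<bullet> c j x)\<bar> \<le> norm e * \<bar>E\<bar> * \<epsilon> ^ Suc j"
          by (simp add: inner_diff_right mult.assoc)
        with up have "\<epsilon> ^ j * (e \<bullet> c j x) \<le> Q * \<epsilon> ^ Suc j"
          unfolding Q_def distrib_right by linarith
        then have "e \<bullet> c j x \<le> Q * \<epsilon>" using \<epsilon> by (simp add: field_simps)
        also have "\<dots> \<le> (Q + 1) * \<epsilon>" using \<epsilon> by simp
        also have "\<dots> < \<gamma> / 2" using \<epsilon>(3) Q by (simp add: field_simps)
        finally show False using x(3) by simp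
      qed
      then show False by (simp add: eventually_False)
    qed
    show ?case
    proof
      fix x assume x: "x \<in> S"
      then obtain s where s: "\<And>i. s i \<in> interior S" "s \<longlonglongrightarrow> x"
        using S closure_sequential[of x "interior S"] by blast
      then have "(\<lambda>i. c j (s i)) \<longlonglongrightarrow> c j x"
        using c(1)[OF j] x interior_subset[of S]
        unfolding continuous_on_sequentially o_def by blast
      then show "c j x = 0" using int s(1) by (simp add: LIMSEQ_const_iff)
    qed
  qed
  obtain E where "\<forall>\<^sub>F \<epsilon> in at_right 0. \<forall>x\<in>S. norm (v \<epsilon> x - (\<Sum>i<Suc k. \<epsilon> ^ i *\<^sub>R c i x)) \<le> E * \<epsilon> ^ Suc k"
    using trunc[of "Suc k"] k by auto
  moreover have "(\<Sum>i<Suc k. \<epsilon> ^ i *\<^sub>R c i x) = 0" if "x \<in> S" for x \<epsilon>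
    using zero that by (intro sum.neutral) auto
  ultimately have "\<forall>\<^sub>F \<epsilon> in at_right 0. \<forall>x\<in>S. norm (v \<epsilon> x) \<le> E * \<epsilon> ^ Suc k"
    by (auto elim!: eventually_mono simp del: sum.lessThan_Suc)
  then show ?thesis by blast
qed

text \<open>
  Each coefficient is the uniform limit, as \<open>\<epsilon>\<close> tends to 0, of the continuous functions obtained by
  subtracting the earlier terms and dividing by \<open>\<epsilon>^i\<close>.
\<close>

lemma asymptotic_expansion_continuous:
  fixes h :: "real \<Rightarrow> 'a::topological_space \<Rightarrow> 'b::real_normed_vector"
  assumes exp: "asymptotic_expansion K h hc"
    and cont: "\<forall>\<^sub>F \<epsilon> in at_right 0. continuous_on K (h \<epsilon>)"
  shows "continuous_on K (hc i)"
proof (induction i rule: less_induct)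
  case (less i)
  obtain C where C: "\<forall>\<^sub>F \<epsilon> in at_right 0. \<forall>x\<in>K.
      norm (h \<epsilon> x - (\<Sum>l\<le>i. \<epsilon> ^ l *\<^sub>R hc l x)) \<le> C * \<epsilon> ^ (i + 1)"
    using exp unfolding asymptotic_expansion_def by blast
  define \<phi> where "\<phi> \<epsilon> x = (1 / \<epsilon> ^ i) *\<^sub>R (h \<epsilon> x - (\<Sum>l<i. \<epsilon> ^ l *\<^sub>R hc l x))" for \<epsilon> x
  show ?case
  proof (rule uniform_limit_theorem)
    show "\<forall>\<^sub>F \<epsilon> in at_right 0. continuous_on K (\<phi> \<epsilon>)"
      using cont by eventually_elim (use less.IH in \<open>auto simp: \<phi>_def intro!: continuous_intros\<close>)
    show "uniform_limit K \<phi> (hc i) (at_right 0)"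
    proof (rule uniform_limitI)
      fix e :: real assume e: "e > 0"
      then have pos: "0 < e / (\<bar>C\<bar> + 1)" by simp
      show "\<forall>\<^sub>F \<epsilon> in at_right 0. \<forall>x\<in>K. dist (\<phi> \<epsilon> x) (hc i x) < e"
        using C eventually_at_right_0_less[OF pos]
      proof eventually_elim
        case (elim \<epsilon>)
        then have \<epsilon>: "\<epsilon> > 0" "\<epsilon> < e / (\<bar>C\<bar> + 1)" by auto
        show ?case
        proof
          fix x assume "x \<in> K"
          have "\<phi> \<epsilon> x - hc i x = (1 / \<epsilon> ^ i) *\<^sub>R (h \<epsilon> x - (\<Sum>l\<le>i. \<epsilon> ^ l *\<^sub>R hc l x))"
            using \<epsilon> by (simp add: \<phi>_def lessThan_Suc_atMost[symmetric] algebra_simps)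
          then have "norm (\<phi> \<epsilon> x - hc i x) = (1 / \<epsilon> ^ i) * norm (h \<epsilon> x - (\<Sum>l\<le>i. \<epsilon> ^ l *\<^sub>R hc l x))"
            using \<epsilon> by simp
          also have "\<dots> \<le> (1 / \<epsilon> ^ i) * (C * \<epsilon> ^ (i + 1))"
            using elim \<open>x \<in> K\<close> \<epsilon> by (intro mult_left_mono) auto
          also have "\<dots> = C * \<epsilon>" using \<epsilon> by simp
          also have "\<dots> \<le> (\<bar>C\<bar> + 1) * \<epsilon>" using \<epsilon> by (intro mult_right_mono) auto
          also have "\<dots> < e" using \<epsilon>(2) by (simp add: field_simps)
          finally show "dist (\<phi> \<epsilon> x) (hc i x) < e" by (simp add: dist_norm)
        qed
      qed
    qed
  qed simp
qed

text \<open>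
  Near a point of \<open>K\<close> finitely many continuous coefficients are bounded.
\<close>

lemma asymptotic_expansion_expandable:
  fixes h :: "real \<Rightarrow> 'a::real_normed_vector \<Rightarrow> 'b::real_normed_vector"
  assumes exp: "asymptotic_expansion K h hc"
    and cont: "\<forall>\<^sub>F \<epsilon> in at_right 0. continuous_on K (h \<epsilon>)" and a: "a \<in> K"
  obtains r where "r > 0" "expandable (Suc n) (K \<inter> ball a r) h"
proof -
  note hc = asymptotic_expansion_continuous[OF exp cont]
  have "\<exists>r>0. \<forall>i<k. bounded (hc i ` (K \<inter> ball a r))" for k
  proof (induction k)
    case 0
    show ?case by (rule exI[of _ 1]) simp
  next
    case (Suc k)
    then obtain r where r: "r > 0" "\<And>i. i < k \<Longrightarrow> bounded (hc i ` (K \<inter> ball a r))" by blast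
    obtain d where d: "d > 0" "\<And>x. x \<in> K \<Longrightarrow> dist x a < d \<Longrightarrow> dist (hc k x) (hc k a) < 1"
      using hc[of k] a unfolding continuous_on_iff by (metis zero_less_one)
    show ?case
    proof (intro exI[of _ "min r d"] conjI allI impI)
      fix i assume "i < Suc k"
      then consider "i < k" | "i = k" by linarith
      then show "bounded (hc i ` (K \<inter> ball a (min r d)))"
      proof cases
        case 1
        then show ?thesis by (rule bounded_subset[OF r(2)]) auto
      next
        case 2
        have "hc k ` (K \<inter> ball a (min r d)) \<subseteq> ball (hc k a) 1"
          using d(2) by (auto simp: dist_commute)
        then show ?thesis using 2 bounded_subset[OF bounded_ball] by blast
      qed
    qed (use r d in simp)
  qed
  then obtain r where r: "r > 0" "\<And>i. i < Suc n \<Longrightarrow> bounded (hc i ` (K \<inter> ball a r))" by blast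
  obtain C where C: "\<forall>\<^sub>F \<epsilon> in at_right 0. \<forall>x\<in>K.
      norm (h \<epsilon> x - (\<Sum>l\<le>n. \<epsilon> ^ l *\<^sub>R hc l x)) \<le> C * \<epsilon> ^ (n + 1)"
    using exp unfolding asymptotic_expansion_def by blast
  have "expandable (Suc n) (K \<inter> ball a r) h"
  proof (rule expandableI[where c = hc and C = C])
    show "continuous_on (K \<inter> ball a r) (hc i)" for i
      by (rule continuous_on_subset[OF hc]) auto
    show "\<forall>\<^sub>F \<epsilon> in at_right 0. \<forall>x\<in>K \<inter> ball a r.
        norm (h \<epsilon> x - (\<Sum>i<Suc n. \<epsilon> ^ i *\<^sub>R hc i x)) \<le> C * \<epsilon> ^ Suc n"
      using C by eventually_elim (simp add: lessThan_Suc_atMost del: sum.lessThan_Suc)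
  qed (use r in blast)
  with r(1) show thesis by (rule that)
qed

section \<open>Scaled time derivatives\<close>

text \<open>
  \<open>\<epsilon>^k\<close> times the \<open>k\<close>-th time derivative of \<open>y\<close>. The parameter \<open>\<epsilon>\<close> is made an argument, along
  which the vector field has component 0, so that smoothness can be used at \<open>\<epsilon> = 0\<close>, where the
  original vector field is singular.
\<close>

primrec scaled_dt ::
  "(real^'s \<Rightarrow> real^'f \<Rightarrow> real \<Rightarrow> real^'s) \<Rightarrow> (real^'s \<Rightarrow> real^'f \<Rightarrow> real \<Rightarrow> real^'f)
    \<Rightarrow> nat \<Rightarrow> (real^'s) \<times> (real^'f) \<times> real \<Rightarrow> real^'f" where
  "scaled_dt f g 0 = (\<lambda>(x, y, \<epsilon>). y)"
| "scaled_dt f g (Suc k) = (\<lambda>(x, y, \<epsilon>).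
     frechet_derivative (scaled_dt f g k) (at (x, y, \<epsilon>)) (\<epsilon> *\<^sub>R f x y \<epsilon>, g x y \<epsilon>, 0))"

lemma scaled_dt_0_frechet:
  "frechet_derivative (scaled_dt f g 0) (at z) v = fst (snd v)"
proof -
  have "(scaled_dt f g 0 has_derivative (\<lambda>v. fst (snd v))) (at z)"
    by (auto simp: case_prod_unfold intro!: derivative_intros)
  from frechet_derivative_at[OF this] show ?thesis by metis
qed

lemma scaled_dt_1: "scaled_dt f g (Suc 0) (x, y, \<epsilon>) = g x y \<epsilon>"
  by (simp only: scaled_dt.simps(2) prod.case scaled_dt_0_frechet fst_conv snd_conv)

lemma Ck_on_scaled_dt:
  fixes f :: "real^'s \<Rightarrow> real^'f \<Rightarrow> real \<Rightarrow> real^'s"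
  assumes f: "\<And>j. Ck_on j (\<lambda>(x, y, \<epsilon>). f x y \<epsilon>) (slab d)"
    and g: "\<And>j. Ck_on j (\<lambda>(x, y, \<epsilon>). g x y \<epsilon>) (slab d)"
  shows "Ck_on j (scaled_dt f g k) (slab d)"
proof (induction k arbitrary: j)
  case 0
  show ?case
    by (rule Ck_on_linear[OF open_slab])
      (auto simp: case_prod_unfold intro!: bounded_linear_compose[OF bounded_linear_fst] bounded_linear_snd)
next
  case (Suc k)
  define V :: "(real^'s) \<times> (real^'f) \<times> real \<Rightarrow> (real^'s) \<times> (real^'f) \<times> real"
    where "V z = snd (snd z) *\<^sub>R ((\<lambda>(x, y, \<epsilon>). f x y \<epsilon>) z, 0, 0) + (0, (\<lambda>(x, y, \<epsilon>). g x y \<epsilon>) z, 0)" for z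
  have eps: "bounded_linear (\<lambda>z::(real^'s) \<times> (real^'f) \<times> real. snd (snd z))"
    by (intro bounded_linear_compose[OF bounded_linear_snd] bounded_linear_snd)
  have "Ck_on j V (slab d)" unfolding V_def
    by (intro Ck_on_add Ck_on_scaleR open_slab Ck_on_linear[OF open_slab eps]
        Ck_on_linear_compose[OF open_slab _ f, where L = "\<lambda>x. (x, 0, 0)"]
        Ck_on_linear_compose[OF open_slab _ g, where L = "\<lambda>y. (0, y, 0)"]
        bounded_linear_Pair bounded_linear_zero bounded_linear_ident)
  from Ck_on_frechet_derivative_apply[OF open_slab Suc.IH this]
  show ?case by (simp add: V_def case_prod_unfold)
qed

lemma dt_y_eq_scaled_dt:
  fixes f :: "real^'s \<Rightarrow> real^'f \<Rightarrow> real \<Rightarrow> real^'s"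
  assumes f: "\<And>j. Ck_on j (\<lambda>(x, y, \<epsilon>). f x y \<epsilon>) (slab d)"
    and g: "\<And>j. Ck_on j (\<lambda>(x, y, \<epsilon>). g x y \<epsilon>) (slab d)"
    and \<epsilon>: "0 < \<epsilon>" "\<epsilon> < d"
  shows "dt_y f g \<epsilon> k (x, y) = (1 / \<epsilon> ^ k) *\<^sub>R scaled_dt f g k (x, y, \<epsilon>)"
proof (induction k arbitrary: x y)
  case (Suc k)
  let ?D = "frechet_derivative (scaled_dt f g k) (at (x, y, \<epsilon>))"
  have eq: "dt_y f g \<epsilon> k = (\<lambda>z. (1 / \<epsilon> ^ k) *\<^sub>R scaled_dt f g k (fst z, snd z, \<epsilon>))"
    using Suc.IH by auto
  have D: "(scaled_dt f g k has_derivative ?D) (at (x, y, \<epsilon>))"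
    using \<epsilon> by (intro Ck_on_Suc_has_derivative[OF Ck_on_scaled_dt[OF f g]]) auto
  have "((\<lambda>z. (fst z, snd z, \<epsilon>)) has_derivative (\<lambda>v. (fst v, snd v, 0))) (at (x, y))"
    by (auto intro!: derivative_eq_intros)
  from has_derivative_compose[OF this, of "scaled_dt f g k" ?D] D
  have "(dt_y f g \<epsilon> k has_derivative (\<lambda>v. (1 / \<epsilon> ^ k) *\<^sub>R ?D (fst v, snd v, 0))) (at (x, y))"
    unfolding eq by (intro has_derivative_scaleR_right) simp
  from frechet_derivative_at[OF this]
  have "dt_y f g \<epsilon> (Suc k) (x, y) = (1 / \<epsilon> ^ k) *\<^sub>R ?D (f x y \<epsilon>, (1 / \<epsilon>) *\<^sub>R g x y \<epsilon>, 0)"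
    by (simp add: vfield_def fun_eq_iff)
  also have "(f x y \<epsilon>, (1 / \<epsilon>) *\<^sub>R g x y \<epsilon>, 0) = (1 / \<epsilon>) *\<^sub>R (\<epsilon> *\<^sub>R f x y \<epsilon>, g x y \<epsilon>, 0::real)"
    using \<epsilon> by simp
  also have "?D \<dots> = (1 / \<epsilon>) *\<^sub>R ?D (\<epsilon> *\<^sub>R f x y \<epsilon>, g x y \<epsilon>, 0)"
    by (rule linear_scale[OF has_derivative_linear[OF D]])
  finally show ?case by (simp add: mult.commute)
qed simp

lemma expandable_bounded:
  assumes "expandable n S u"
  shows "\<exists>C. \<forall>\<^sub>F \<epsilon> in at_right 0. \<forall>x\<in>S. norm (u \<epsilon> x) \<le> C"
proof -
  obtain C c where "C \<ge> 0"
    and c: "\<forall>i<n. continuous_on S (c i)" "\<forall>i<n. bounded (c i ` S)"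
    and C: "\<forall>\<^sub>F \<epsilon> in at_right 0. \<forall>x\<in>S. norm (u \<epsilon> x - (\<Sum>i<n. \<epsilon> ^ i *\<^sub>R c i x)) \<le> C * \<epsilon> ^ n"
    by (rule expandableE[OF assms])
  from expansion_truncate[OF c(2)[rule_format] C, of 0] show ?thesis by simp
qed

text \<open>
  On the graph of \<open>h\<close> the direction \<open>(\<epsilon> f, g, 0)\<close> is \<open>\<epsilon>\<close> times the tangent vector
  \<open>(f, Dh f, 0)\<close>, by invariance; hence each scaled time derivative restricted to the graph is \<open>\<epsilon>\<close>
  times the derivative of the preceding one along the slow velocity.
\<close>

lemma scaled_dt_on_slow_manifold:
  fixes f :: "real^'s \<Rightarrow> real^'f \<Rightarrow> real \<Rightarrow> real^'s"
  assumes d: "d > 0"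
    and f: "\<And>j. Ck_on j (\<lambda>(x, y, \<epsilon>). f x y \<epsilon>) (slab d)"
    and g: "\<And>j. Ck_on j (\<lambda>(x, y, \<epsilon>). g x y \<epsilon>) (slab d)"
    and S: "bounded S" "S \<subseteq> closure (interior S)"
    and h: "n > 0" "expandable n S h"
    and Dh: "\<And>\<epsilon> x. \<lbrakk>0 < \<epsilon>; \<epsilon> < d; x \<in> interior S\<rbrakk> \<Longrightarrow> (h \<epsilon> has_derivative Dh \<epsilon> x) (at x)"
    and inv: "\<And>\<epsilon> x. \<lbrakk>0 < \<epsilon>; \<epsilon> < d; x \<in> interior S\<rbrakk> \<Longrightarrow>
      g x (h \<epsilon> x) \<epsilon> = \<epsilon> *\<^sub>R Dh \<epsilon> x (f x (h \<epsilon> x) \<epsilon>)"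
    and k: "k \<le> n"
  shows "\<exists>C. \<forall>\<^sub>F \<epsilon> in at_right 0. \<forall>x\<in>S. norm (scaled_dt f g k (x, h \<epsilon> x, \<epsilon>)) \<le> C * \<epsilon> ^ k"
  using k
proof (induction k)
  case 0
  show ?case using expandable_bounded[OF h(2)] by simp
next
  case (Suc k)
  let ?D = "\<lambda>\<epsilon> x. frechet_derivative (scaled_dt f g k) (at (x, h \<epsilon> x, \<epsilon>))"
  obtain C where C: "\<forall>\<^sub>F \<epsilon> in at_right 0. \<forall>x\<in>S. norm (scaled_dt f g k (x, h \<epsilon> x, \<epsilon>)) \<le> C * \<epsilon> ^ k"
    using Suc by auto
  have "expandable n S (\<lambda>\<epsilon> x. f x (h \<epsilon> x) \<epsilon>)"
    using expandable_compose[OF d S(1) h f] by simp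
  then obtain A where A: "\<forall>\<^sub>F \<epsilon> in at_right 0. \<forall>x\<in>S. norm (f x (h \<epsilon> x) \<epsilon>) \<le> A"
    using expandable_bounded by blast
  show ?case
  proof (rule slow_derivative_order[OF _ _ S(2) C A])
    show "expandable n S (\<lambda>\<epsilon> x. scaled_dt f g (Suc k) (x, h \<epsilon> x, \<epsilon>))"
      by (rule expandable_compose[OF d S(1) h Ck_on_scaled_dt[OF f g]])
    show "k < n" using Suc.prems by simp
    show "\<forall>\<^sub>F \<epsilon> in at_right 0. \<forall>x\<in>interior S.
        ((\<lambda>x. scaled_dt f g k (x, h \<epsilon> x, \<epsilon>)) has_derivative (\<lambda>v. ?D \<epsilon> x (v, Dh \<epsilon> x v, 0))) (at x) \<and>
        scaled_dt f g (Suc k) (x, h \<epsilon> x, \<epsilon>) =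
          \<epsilon> *\<^sub>R ?D \<epsilon> x (f x (h \<epsilon> x) \<epsilon>, Dh \<epsilon> x (f x (h \<epsilon> x) \<epsilon>), 0)"
      using eventually_at_right_0_less[OF d]
    proof eventually_elim
      case (elim \<epsilon>)
      show ?case
      proof (intro ballI conjI)
        fix x assume x: "x \<in> interior S"
        have D: "(scaled_dt f g k has_derivative ?D \<epsilon> x) (at (x, h \<epsilon> x, \<epsilon>))"
          using elim by (intro Ck_on_Suc_has_derivative[OF Ck_on_scaled_dt[OF f g]]) auto
        have "((\<lambda>x. (x, h \<epsilon> x, \<epsilon>)) has_derivative (\<lambda>v. (v, Dh \<epsilon> x v, 0))) (at x)"
          using Dh[of \<epsilon> x] elim x by (auto intro!: derivative_intros)
        from has_derivative_compose[OF this D]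
        show "((\<lambda>x. scaled_dt f g k (x, h \<epsilon> x, \<epsilon>)) has_derivative (\<lambda>v. ?D \<epsilon> x (v, Dh \<epsilon> x v, 0))) (at x)" .
        have "(\<epsilon> *\<^sub>R f x (h \<epsilon> x) \<epsilon>, g x (h \<epsilon> x) \<epsilon>, 0)
            = \<epsilon> *\<^sub>R (f x (h \<epsilon> x) \<epsilon>, Dh \<epsilon> x (f x (h \<epsilon> x) \<epsilon>), 0::real)"
          using inv[of \<epsilon> x] elim x by simp
        then show "scaled_dt f g (Suc k) (x, h \<epsilon> x, \<epsilon>) =
          \<epsilon> *\<^sub>R ?D \<epsilon> x (f x (h \<epsilon> x) \<epsilon>, Dh \<epsilon> x (f x (h \<epsilon> x) \<epsilon>), 0)"
          by (simp only: scaled_dt.simps(2) prod.case linear_scale[OF has_derivative_linear[OF D]])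
      qed
    qed
  qed
qed

text \<open>
  At \<open>\<epsilon> = 0\<close> the function \<open>P\<^sub>k\<^sub>+\<^sub>1\<close> is \<open>D\<^sub>yP\<^sub>k\<close> applied to \<open>g\<close>. In the product rule the term with the
  second derivative of \<open>P\<^sub>k\<close> carries the factor \<open>g\<close> and drops out at a zero of \<open>g\<close>.
\<close>

lemma partial_derivative_scaled_dt:
  fixes f :: "real^'s \<Rightarrow> real^'f \<Rightarrow> real \<Rightarrow> real^'s"
  assumes d: "d > 0"
    and f: "\<And>j. Ck_on j (\<lambda>(x, y, \<epsilon>). f x y \<epsilon>) (slab d)"
    and g: "\<And>j. Ck_on j (\<lambda>(x, y, \<epsilon>). g x y \<epsilon>) (slab d)"
    and eq: "g a b 0 = 0"
  shows "frechet_derivative (scaled_dt f g (Suc k)) (at (a, b, 0)) (0, v, 0)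
    = frechet_derivative (scaled_dt f g k) (at (a, b, 0)) (0, frechet_derivative (\<lambda>y. g a y 0) (at b) v, 0)"
proof -
  let ?D = "\<lambda>k y. frechet_derivative (scaled_dt f g k) (at (a, y, 0))"
  let ?B = "frechet_derivative (\<lambda>y. g a y 0) (at b)"
  have emb: "((\<lambda>y::real^'f. (a, y, 0::real)) has_derivative (\<lambda>v. (0, v, 0))) (at y)" for y
    by (auto intro!: derivative_intros)
  have D: "(scaled_dt f g k has_derivative ?D k y) (at (a, y, 0))" for k y
    using d by (intro Ck_on_Suc_has_derivative[OF Ck_on_scaled_dt[OF f g]]) auto
  have part: "((\<lambda>y. scaled_dt f g k (a, y, 0)) has_derivative (\<lambda>v. ?D k y (0, v, 0))) (at y)" for k y
    using has_derivative_compose[OF emb D] .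
  have "(\<lambda>y. g a y 0) differentiable (at b)"
    using part[of "Suc 0" b] unfolding scaled_dt_1 by (auto simp: differentiable_def)
  then have B: "((\<lambda>y. g a y 0) has_derivative ?B) (at b)"
    using frechet_derivative_works by blast
  have lin: "linear (\<lambda>v. ?D k y (0, v, 0))" for k y
    using has_derivative_linear[OF part] .
  have rep: "?D k y (0, w, 0) = (\<Sum>i\<in>Basis. (w \<bullet> i) *\<^sub>R ?D k y (0, i, 0))" for k y w
  proof -
    have "?D k y (0, w, 0) = ?D k y (0, \<Sum>i\<in>Basis. (w \<bullet> i) *\<^sub>R i, 0)"
      by (simp add: euclidean_representation)
    then show ?thesis by (simp only: linear_sum[OF lin] linear_scale[OF lin])
  qed
  have "((\<lambda>y. scaled_dt f g (Suc k) (a, y, 0)) has_derivative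
      (\<lambda>v. \<Sum>i\<in>Basis. (?B v \<bullet> i) *\<^sub>R ?D k b (0, i, 0))) (at b)"
  proof -
    have "((\<lambda>y. (g a y 0 \<bullet> i) *\<^sub>R ?D k y (0, i, 0)) has_derivative
        (\<lambda>v. (?B v \<bullet> i) *\<^sub>R ?D k b (0, i, 0))) (at b)" for i
    proof -
      have "Ck_on (Suc 0) (\<lambda>z. frechet_derivative (scaled_dt f g k) (at z) (0, i, 0)) (slab d)"
        by (rule Ck_on_frechet_derivative[OF Ck_on_scaled_dt[OF f g]])
      from Ck_on_Suc_has_derivative[OF this, of "(a, b, 0)"] d
      have "((\<lambda>z. frechet_derivative (scaled_dt f g k) (at z) (0, i, 0)) has_derivative
        frechet_derivative (\<lambda>z. frechet_derivative (scaled_dt f g k) (at z) (0, i, 0)) (at (a, b, 0))) (at (a, b, 0))"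
        by simp
      from has_derivative_scaleR[OF has_derivative_inner_left[OF B] has_derivative_compose[OF emb this]]
      show ?thesis by (simp add: eq)
    qed
    then have "((\<lambda>y. \<Sum>i\<in>Basis. (g a y 0 \<bullet> i) *\<^sub>R ?D k y (0, i, 0)) has_derivative
        (\<lambda>v. \<Sum>i\<in>Basis. (?B v \<bullet> i) *\<^sub>R ?D k b (0, i, 0))) (at b)"
      by (intro has_derivative_sum) auto
    then show ?thesis by (simp add: rep[symmetric])
  qed
  from fun_cong[OF has_derivative_unique[OF part this], of v] rep[of k b "?B v"] show ?thesis
    by (rule trans[OF _ sym])
qed

lemma inj_partial_derivative_scaled_dt:
  fixes f :: "real^'s \<Rightarrow> real^'f \<Rightarrow> real \<Rightarrow> real^'s"
  assumes d: "d > 0"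
    and f: "\<And>j. Ck_on j (\<lambda>(x, y, \<epsilon>). f x y \<epsilon>) (slab d)"
    and g: "\<And>j. Ck_on j (\<lambda>(x, y, \<epsilon>). g x y \<epsilon>) (slab d)"
    and eq: "g a b 0 = 0" and B: "inj (frechet_derivative (\<lambda>y. g a y 0) (at b))"
  shows "inj (\<lambda>v. frechet_derivative (scaled_dt f g k) (at (a, b, 0)) (0, v, 0))"
proof (induction k)
  case 0
  show ?case by (simp only: scaled_dt_0_frechet) (simp add: inj_def)
next
  case (Suc k)
  show ?case
    unfolding partial_derivative_scaled_dt[where f = f and g = g, OF d f g eq]
    using inj_compose[OF Suc.IH B] by (simp add: o_def)
qed

text \<open>
  Near \<open>(a, b, 0)\<close> the partial derivative in the second variable stays within half the lower bound \<open>B\<close>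
  of its value \<open>A\<close> at that point, so \<open>p - A\<close> has Lipschitz constant \<open>B / 2\<close> there.
\<close>

lemma uniformly_locally_expanding:
  fixes p :: "'a::euclidean_space \<times> 'b::euclidean_space \<times> real \<Rightarrow> 'c::euclidean_space"
  assumes p: "Ck_on (Suc 0) p (slab d)" and d: "d > 0"
    and inj: "inj (\<lambda>v. frechet_derivative p (at (a, b, 0)) (0, v, 0))"
  obtains c \<rho> where "c > 0" "\<rho> > 0"
    "\<And>y y' \<epsilon>. \<lbrakk>y \<in> ball b \<rho>; y' \<in> ball b \<rho>; \<bar>\<epsilon>\<bar> < \<rho>\<rbrakk> \<Longrightarrow>
      c * norm (y - y') \<le> norm (p (a, y, \<epsilon>) - p (a, y', \<epsilon>))"
proof -
  let ?D = "\<lambda>z. frechet_derivative p (at z)"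
  define A where "A v = ?D (a, b, 0) (0, v, 0)" for v
  have part: "((\<lambda>y. p (a, y, \<epsilon>)) has_derivative (\<lambda>v. ?D (a, y, \<epsilon>) (0, v, 0))) (at y)"
    if "-d < \<epsilon>" "\<epsilon> < d" for y \<epsilon>
  proof -
    have "((\<lambda>y. (a, y, \<epsilon>)) has_derivative (\<lambda>v. (0, v, 0))) (at y)"
      by (auto intro!: derivative_intros)
    from has_derivative_compose[OF this Ck_on_Suc_has_derivative[OF p]] that show ?thesis by simp
  qed
  have linA: "linear A" unfolding A_def using has_derivative_linear[OF part[of 0 b]] d by simp
  obtain B where B: "B > 0" "\<And>v. B * norm v \<le> norm (A v)"
    using linear_inj_bounded_below_pos[OF linA] inj unfolding A_def by blast
  \<comment> \<open>Errors below \<open>\<eta>\<close> in each basis direction add up to an operator norm of at most \<open>B / 2\<close>.\<close>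
  define \<eta> where "\<eta> = B / (2 * real DIM('b))"
  have \<eta>: "\<eta> > 0" using B by (simp add: \<eta>_def)
  have "\<forall>\<^sub>F z in nhds (a, b, 0). norm (?D z (0, i, 0) - A i) < \<eta>" for i
  proof -
    have "continuous_on (slab d) (\<lambda>z. ?D z (0, i, 0))"
      using Ck_on_frechet_derivative[OF p] by simp
    then have "isCont (\<lambda>z. ?D z (0, i, 0)) (a, b, 0)"
      using d by (simp add: continuous_on_eq_continuous_at[OF open_slab])
    then have "((\<lambda>z. ?D z (0, i, 0)) \<longlongrightarrow> A i) (nhds (a, b, 0))"
      using tendsto_at_iff_tendsto_nhds[of "\<lambda>z. ?D z (0, i, 0)" "(a, b, 0)"]
      unfolding A_def isCont_def by simp
    from tendstoD[OF this \<eta>] show ?thesis by (simp add: dist_norm)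
  qed
  then have "\<forall>\<^sub>F z in nhds (a, b, 0). \<forall>i\<in>Basis. norm (?D z (0, i, 0) - A i) < \<eta>"
    by (intro eventually_ball_finite) auto
  then obtain r where r: "r > 0"
    "\<And>z i. dist z (a, b, 0) < r \<Longrightarrow> i \<in> Basis \<Longrightarrow> norm (?D z (0, i, 0) - A i) < \<eta>"
    unfolding eventually_nhds_metric by blast
  define \<rho> where "\<rho> = min d (r / 2)"
  show thesis
  proof (rule that[of "B / 2" \<rho>])
    fix y y' \<epsilon> assume y: "y \<in> ball b \<rho>" "y' \<in> ball b \<rho>" and \<epsilon>: "\<bar>\<epsilon>\<bar> < \<rho>"
    then have \<epsilon>d: "-d < \<epsilon>" "\<epsilon> < d" by (auto simp: \<rho>_def)
    have "norm ((p (a, y, \<epsilon>) - A y) - (p (a, y', \<epsilon>) - A y')) \<le> B / 2 * norm (y - y')"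
    proof (rule differentiable_bound[where f = "\<lambda>y. p (a, y, \<epsilon>) - A y"
          and f' = "\<lambda>u v. ?D (a, u, \<epsilon>) (0, v, 0) - A v", OF convex_ball _ _ y])
      fix u assume u: "u \<in> ball b \<rho>"
      show "((\<lambda>y. p (a, y, \<epsilon>) - A y) has_derivative (\<lambda>v. ?D (a, u, \<epsilon>) (0, v, 0) - A v)) (at u within ball b \<rho>)"
        by (rule has_derivative_at_withinI[OF has_derivative_diff[OF part[OF \<epsilon>d]
              linear_imp_has_derivative[OF linA]]])
      have lin: "linear (\<lambda>v. ?D (a, u, \<epsilon>) (0, v, 0) - A v)"
        by (intro linear_compose_sub linA has_derivative_linear[OF part[OF \<epsilon>d]])
      have "dist (a, u, \<epsilon>) (a, b, 0) \<le> norm (u - b) + norm \<epsilon>"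
        using norm_Pair_le[of "u - b" \<epsilon>] by (simp add: dist_norm norm_Pair)
      also have "\<dots> < r" using u \<epsilon> by (auto simp: \<rho>_def dist_norm norm_minus_commute)
      finally have close: "norm (?D (a, u, \<epsilon>) (0, i, 0) - A i) < \<eta>" if "i \<in> Basis" for i
        using r(2) that by blast
      show "onorm (\<lambda>v. ?D (a, u, \<epsilon>) (0, v, 0) - A v) \<le> B / 2"
      proof (rule onorm_bound)
        fix v
        have "?D (a, u, \<epsilon>) (0, v, 0) - A v = (\<Sum>i\<in>Basis. (v \<bullet> i) *\<^sub>R (?D (a, u, \<epsilon>) (0, i, 0) - A i))"
          using linear_sum[OF lin, of "\<lambda>i. (v \<bullet> i) *\<^sub>R i" Basis] linear_scale[OF lin]
          by (simp add: euclidean_representation)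
        also have "norm \<dots> \<le> (\<Sum>i\<in>(Basis::'b set). norm v * \<eta>)"
        proof (rule sum_norm_le)
          fix i :: 'b assume i: "i \<in> Basis"
          show "norm ((v \<bullet> i) *\<^sub>R (?D (a, u, \<epsilon>) (0, i, 0) - A i)) \<le> norm v * \<eta>"
            using close[OF i] Basis_le_norm[OF i, of v] \<eta> unfolding norm_scaleR
            by (intro mult_mono) auto
        qed
        also have "\<dots> = B / 2 * norm v" by (simp add: \<eta>_def)
        finally show "norm (?D (a, u, \<epsilon>) (0, v, 0) - A v) \<le> B / 2 * norm v" .
      qed (use B in simp)
    qed
    then have "norm ((p (a, y, \<epsilon>) - p (a, y', \<epsilon>)) - A (y - y')) \<le> B / 2 * norm (y - y')"
      by (simp add: linear_diff[OF linA] algebra_simps)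
    moreover have "norm (A (y - y')) \<le> norm (p (a, y, \<epsilon>) - p (a, y', \<epsilon>))
        + norm ((p (a, y, \<epsilon>) - p (a, y', \<epsilon>)) - A (y - y'))"
      using norm_triangle_sub[of "A (y - y')" "p (a, y, \<epsilon>) - p (a, y', \<epsilon>)"]
      by (simp only: norm_minus_commute)
    ultimately show "B / 2 * norm (y - y') \<le> norm (p (a, y, \<epsilon>) - p (a, y', \<epsilon>))"
      using B(2)[of "y - y'"] by simp
  qed (use B d r in \<open>auto simp: \<rho>_def\<close>)
qed

section \<open>The output of the algorithm\<close>

text \<open>
  The radius \<open>\<delta>\<close> is half of that on which \<open>P\<^sub>n\<close> expands distances: termination leaves
  the last iterate but one within a vanishing distance of the output, hence inside the full radius.
\<close>

theorem mainTheorem5: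
  fixes f :: "real^'s \<Rightarrow> real^'f \<Rightarrow> real \<Rightarrow> real^'s"
    and g :: "real^'s \<Rightarrow> real^'f \<Rightarrow> real \<Rightarrow> real^'f"
    and \<epsilon>1 \<beta> :: real
    and K :: "(real^'s) set"
    and h :: "real \<Rightarrow> real^'s \<Rightarrow> real^'f"
    and Dh :: "real \<Rightarrow> real^'s \<Rightarrow> real^'s \<Rightarrow> real^'f"
    and hc :: "nat \<Rightarrow> real^'s \<Rightarrow> real^'f"
    and x0 :: "real^'s"
    and m :: nat
  assumes eps1: "\<epsilon>1 > 0"
    and smooth_f: "smooth_on (\<lambda>(x, y, \<epsilon>). f x y \<epsilon>) (UNIV \<times> UNIV \<times> {-\<epsilon>1<..<\<epsilon>1})"
    and smooth_g: "smooth_on (\<lambda>(x, y, \<epsilon>). g x y \<epsilon>) (UNIV \<times> UNIV \<times> {-\<epsilon>1<..<\<epsilon>1})"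
    and nondegenerate: "\<forall>x y. g x y 0 = 0 \<longrightarrow> det (Dy g x y 0) \<noteq> 0"
    and K_regular: "K \<subseteq> closure (interior K)"
    and Dh: "\<forall>\<epsilon>\<in>{0<..<\<epsilon>1}. \<forall>x\<in>K. (h \<epsilon> has_derivative Dh \<epsilon> x) (at x within K)"
    and invariance: "\<forall>\<epsilon>\<in>{0<..<\<epsilon>1}. \<forall>x\<in>K.
          g x (h \<epsilon> x) \<epsilon> - \<epsilon> *\<^sub>R Dh \<epsilon> x (f x (h \<epsilon> x) \<epsilon>) = 0"
    and expansion: "asymptotic_expansion K h hc"
    and beta: "\<beta> > 0"
    and attracting: "\<forall>x\<in>K. \<forall>\<mu>. complex_eigenvalue (Dy g x (hc 0 x) 0) \<mu> \<longrightarrow> Re \<mu> \<le> - \<beta>"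
    and x0: "x0 \<in> K"
  shows "\<exists>\<delta>>0. \<forall>H TOL :: real \<Rightarrow> real.
           (\<forall>\<^sub>F \<epsilon> in at_right 0. H \<epsilon> > 0) \<and>
           H \<in> \<Theta>[at_right 0](\<lambda>\<epsilon>. \<epsilon>) \<and>
           TOL \<in> O[at_right 0](\<lambda>\<epsilon>. \<epsilon> ^ (m + 1)) \<longrightarrow>
           (\<exists>C. \<forall>\<^sub>F \<epsilon> in at_right 0. \<forall>seed y.
              algorithm_output (F_map f g \<epsilon> (H \<epsilon>) m x0) (TOL \<epsilon>) seed y \<and> dist y (hc 0 x0) < \<delta> \<longrightarrow>
              norm (y - h \<epsilon> x0) \<le> C * \<epsilon> ^ (m + 1))"
proof -
  define n where "n = Suc m"
  let ?P = "scaled_dt f g"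
  let ?b = "hc 0 x0"
  have f: "Ck_on j (\<lambda>(x, y, \<epsilon>). f x y \<epsilon>) (slab \<epsilon>1)"
    and g: "Ck_on j (\<lambda>(x, y, \<epsilon>). g x y \<epsilon>) (slab \<epsilon>1)" for j
    using smooth_f smooth_g by (simp_all add: smooth_on_def slab_def)
  have "\<forall>\<^sub>F \<epsilon> in at_right 0. continuous_on K (h \<epsilon>)"
    using eventually_at_right_0_less[OF eps1]
  proof eventually_elim
    case (elim \<epsilon>)
    then have "(h \<epsilon> has_derivative Dh \<epsilon> x) (at x within K)" if "x \<in> K" for x
      using Dh that by simp
    then show ?case by (rule has_derivative_continuous_on)
  qed
  from asymptotic_expansion_expandable[OF expansion this x0, of m]
  obtain r where r: "r > 0" "expandable n (K \<inter> ball x0 r) h" unfolding n_def by blast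
  define S where "S = K \<inter> ball x0 r"
  have x0S: "x0 \<in> S" using x0 r by (simp add: S_def)
  have S: "bounded S" "S \<subseteq> closure (interior S)"
  proof -
    show "bounded S" unfolding S_def by (rule bounded_subset[OF bounded_ball]) blast
    have "S \<subseteq> ball x0 r \<inter> closure (interior K)" using K_regular by (auto simp: S_def)
    also have "\<dots> \<subseteq> closure (ball x0 r \<inter> interior K)" by (rule open_Int_closure_subset[OF open_ball])
    also have "ball x0 r \<inter> interior K = interior S" by (auto simp: S_def interior_Int)
    finally show "S \<subseteq> closure (interior S)" .
  qed
  have slow: "\<exists>C. \<forall>\<^sub>F \<epsilon> in at_right 0. \<forall>x\<in>S. norm (?P k (x, h \<epsilon> x, \<epsilon>)) \<le> C * \<epsilon> ^ k" if "k \<le> n" for k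
  proof (rule scaled_dt_on_slow_manifold[OF eps1 f g S _ _ _ _ that])
    fix \<epsilon> x assume \<epsilon>: "0 < \<epsilon>" "\<epsilon> < \<epsilon>1" and x: "x \<in> interior S"
    then have xK: "x \<in> interior K" "x \<in> K" using interior_subset[of K] by (auto simp: S_def interior_Int)
    then show "(h \<epsilon> has_derivative Dh \<epsilon> x) (at x)"
      using Dh \<epsilon> by (auto simp: at_within_interior[OF xK(1), symmetric])
    show "g x (h \<epsilon> x) \<epsilon> = \<epsilon> *\<^sub>R Dh \<epsilon> x (f x (h \<epsilon> x) \<epsilon>)"
      using invariance \<epsilon> xK by simp
  qed (use r in \<open>simp_all add: n_def S_def\<close>)
  obtain Ch where "\<forall>\<^sub>F \<epsilon> in at_right 0. \<forall>x\<in>S. norm (?P n (x, h \<epsilon> x, \<epsilon>)) \<le> Ch * \<epsilon> ^ n"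
    using slow[OF order_refl] by blast
  then have Ch: "\<forall>\<^sub>F \<epsilon> in at_right 0. norm (?P n (x0, h \<epsilon> x0, \<epsilon>)) \<le> Ch * \<epsilon> ^ n"
    by eventually_elim (use x0S in blast)
  have h_lim: "((\<lambda>\<epsilon>. h \<epsilon> x0) \<longlongrightarrow> ?b) (at_right 0)"
  proof -
    obtain C where C: "\<forall>\<^sub>F \<epsilon> in at_right 0. \<forall>x\<in>K. norm (h \<epsilon> x - (\<Sum>i\<le>0. \<epsilon> ^ i *\<^sub>R hc i x)) \<le> C * \<epsilon> ^ (0 + 1)"
      using expansion unfolding asymptotic_expansion_def by blast
    then have "\<forall>\<^sub>F \<epsilon> in at_right 0. norm (h \<epsilon> x0 - ?b) \<le> C * \<epsilon>"
      by eventually_elim (use x0 in auto)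
    moreover have "((\<lambda>\<epsilon>. C * \<epsilon>) \<longlongrightarrow> 0) (at_right 0)" by (auto intro!: tendsto_eq_intros)
    ultimately have "((\<lambda>\<epsilon>. h \<epsilon> x0 - ?b) \<longlongrightarrow> 0) (at_right 0)" by (rule Lim_null_comparison)
    then show ?thesis by (simp add: LIM_zero_iff)
  qed
  have g0: "g x0 ?b 0 = 0"
  proof -
    obtain C where "\<forall>\<^sub>F \<epsilon> in at_right 0. \<forall>x\<in>S. norm (?P (Suc 0) (x, h \<epsilon> x, \<epsilon>)) \<le> C * \<epsilon> ^ Suc 0"
      using slow[of "Suc 0"] unfolding n_def by blast
    then have "\<forall>\<^sub>F \<epsilon> in at_right 0. norm (g x0 (h \<epsilon> x0) \<epsilon>) \<le> C * \<epsilon>"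
      unfolding scaled_dt_1 by eventually_elim (use x0S in auto)
    moreover have "((\<lambda>\<epsilon>. C * \<epsilon>) \<longlongrightarrow> 0) (at_right 0)" by (auto intro!: tendsto_eq_intros)
    ultimately have "((\<lambda>\<epsilon>. g x0 (h \<epsilon> x0) \<epsilon>) \<longlongrightarrow> 0) (at_right 0)" by (rule Lim_null_comparison)
    moreover have "((\<lambda>\<epsilon>. g x0 (h \<epsilon> x0) \<epsilon>) \<longlongrightarrow> g x0 ?b 0) (at_right 0)"
    proof -
      have "isCont (\<lambda>(x, y, \<epsilon>). g x y \<epsilon>) (x0, ?b, 0)"
        using Ck_on_imp_continuous_on[OF g[of 0]] eps1 by (simp add: continuous_on_eq_continuous_at[OF open_slab])
      moreover have "((\<lambda>\<epsilon>. (x0, h \<epsilon> x0, \<epsilon>)) \<longlongrightarrow> (x0, ?b, 0)) (at_right 0)"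
        by (intro tendsto_Pair tendsto_const h_lim tendsto_ident_at)
      ultimately show ?thesis using isCont_tendsto_compose by fastforce
    qed
    ultimately show ?thesis using tendsto_unique trivial_limit_at_right_real by blast
  qed
  have inj: "inj (frechet_derivative (\<lambda>y. g x0 y 0) (at ?b))"
  proof -
    have "((\<lambda>y. (x0, y, 0::real)) has_derivative (\<lambda>v. (0, v, 0))) (at ?b)"
      by (auto intro!: derivative_intros)
    from has_derivative_compose[OF this Ck_on_Suc_has_derivative[OF g]] eps1
    have "(\<lambda>y. g x0 y 0) differentiable (at ?b)" by (auto simp: differentiable_def)
    then have "linear (frechet_derivative (\<lambda>y. g x0 y 0) (at ?b))" by (rule linear_frechet_derivative)
    moreover have "det (matrix (frechet_derivative (\<lambda>y. g x0 y 0) (at ?b))) \<noteq> 0"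
      using nondegenerate g0 unfolding Dy_def by blast
    ultimately show ?thesis using det_nz_iff_inj by blast
  qed
  obtain c \<rho> where c: "c > 0" and \<rho>: "\<rho> > 0"
    and expand: "\<And>y y' \<epsilon>. \<lbrakk>y \<in> ball ?b \<rho>; y' \<in> ball ?b \<rho>; \<bar>\<epsilon>\<bar> < \<rho>\<rbrakk> \<Longrightarrow>
      c * norm (y - y') \<le> norm (?P n (x0, y, \<epsilon>) - ?P n (x0, y', \<epsilon>))"
    using uniformly_locally_expanding[OF Ck_on_scaled_dt[OF f g] eps1
        inj_partial_derivative_scaled_dt[where f = f and g = g, OF eps1 f g g0 inj], of n] by blast
  show ?thesis
  proof (rule exI[of _ "\<rho> / 2"], intro conjI allI impI)
    show "0 < \<rho> / 2" using \<rho> by simp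
    fix H TOL :: "real \<Rightarrow> real"
    assume "(\<forall>\<^sub>F \<epsilon> in at_right 0. H \<epsilon> > 0) \<and> H \<in> \<Theta>[at_right 0](\<lambda>\<epsilon>. \<epsilon>) \<and>
      TOL \<in> O[at_right 0](\<lambda>\<epsilon>. \<epsilon> ^ (m + 1))"
    then have H: "\<forall>\<^sub>F \<epsilon> in at_right 0. H \<epsilon> > 0" "H \<in> \<Theta>[at_right 0](\<lambda>\<epsilon>. \<epsilon>)"
      and TOL: "TOL \<in> O[at_right 0](\<lambda>\<epsilon>. \<epsilon> ^ (m + 1))" by blast+
    obtain q where q: "q > 0" "\<forall>\<^sub>F \<epsilon> in at_right 0. q * norm \<epsilon> \<le> norm (H \<epsilon>)"
      using landau_omega.bigE[OF bigthetaD2[OF H(2)]] by blast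
    obtain T where T: "T > 0" "\<forall>\<^sub>F \<epsilon> in at_right 0. norm (TOL \<epsilon>) \<le> T * norm (\<epsilon> ^ (m + 1))"
      using landau_o.bigE[OF TOL] by blast
    define C where "C = T + (T / q ^ n + Ch) / c"
    have h_near: "\<forall>\<^sub>F \<epsilon> in at_right 0. dist (h \<epsilon> x0) ?b < \<rho>" by (rule tendstoD[OF h_lim \<rho>])
    have pos: "0 < min 1 (min \<epsilon>1 (min \<rho> (\<rho> / (2 * T))))" using eps1 \<rho> T by simp
    have "\<forall>\<^sub>F \<epsilon> in at_right 0. \<forall>seed y.
      algorithm_output (F_map f g \<epsilon> (H \<epsilon>) m x0) (TOL \<epsilon>) seed y \<and> dist y ?b < \<rho> / 2 \<longrightarrow>
              norm (y - h \<epsilon> x0) \<le> C * \<epsilon> ^ (m + 1)"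
      using H(1) q(2) T(2) Ch h_near eventually_at_right_0_less[OF pos]
    proof eventually_elim
      case (elim \<epsilon>)
      then have \<epsilon>: "0 < \<epsilon>" "\<epsilon> < 1" "\<epsilon> < \<epsilon>1" "\<epsilon> < \<rho>" "\<epsilon> < \<rho> / (2 * T)" by auto
      show ?case
      proof (intro allI impI, elim conjE)
        fix seed y
        assume out: "algorithm_output (F_map f g \<epsilon> (H \<epsilon>) m x0) (TOL \<epsilon>) seed y"
          and y: "dist y ?b < \<rho> / 2"
        let ?F = "F_map f g \<epsilon> (H \<epsilon>) m x0"
        obtain s where s: "s \<ge> 1" "norm (iterate ?F seed (s + 1) - iterate ?F seed s) < TOL \<epsilon>"
          and ys: "y = iterate ?F seed (s + 1)"
          using out unfolding algorithm_output_def by blast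
        \<comment> \<open>The stopping test measures the correction, hence \<open>P\<^sub>n\<close>, at the last iterate but one.\<close>
        define y' where "y' = iterate ?F seed s"
        have yF: "y = ?F y'"
          using s(1) unfolding ys y'_def iterate_def by (cases s) auto
        have tol: "norm (y - y') < T * \<epsilon> ^ n"
          using s(2) elim(3) \<epsilon> unfolding ys y'_def n_def by simp
        have "T * \<epsilon> ^ n \<le> T * \<epsilon>"
          using \<epsilon> T(1) power_decreasing[of 1 n \<epsilon>] by (intro mult_left_mono) (auto simp: n_def)
        also have "\<dots> < \<rho> / 2" using \<epsilon>(5) T(1) by (simp add: field_simps)
        finally have "norm (y - y') < \<rho> / 2" using tol by simp
        then have y'b: "y' \<in> ball ?b \<rho>"
          using y dist_triangle[of ?b y' y] by (simp add: dist_norm norm_minus_commute)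
        have "y - y' = - ((- H \<epsilon>) ^ n *\<^sub>R (1 / \<epsilon> ^ n) *\<^sub>R ?P n (x0, y', \<epsilon>))"
          using yF dt_y_eq_scaled_dt[where f = f and g = g, OF f g \<epsilon>(1,3)] by (simp add: F_map_def L_map_def n_def del: dt_y.simps scaled_dt.simps power_Suc)
        then have "norm (y - y') = (H \<epsilon> / \<epsilon>) ^ n * norm (?P n (x0, y', \<epsilon>))"
          using elim(1) \<epsilon> by (simp add: power_abs power_divide)
        moreover have "q ^ n \<le> (H \<epsilon> / \<epsilon>) ^ n"
          using elim(1,2) \<epsilon> q(1) by (intro power_mono) (auto simp: field_simps)
        ultimately have "q ^ n * norm (?P n (x0, y', \<epsilon>)) \<le> norm (y - y')"
          by (simp add: mult_right_mono)
        with tol have "q ^ n * norm (?P n (x0, y', \<epsilon>)) \<le> T * \<epsilon> ^ n" by linarith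
        then have P': "norm (?P n (x0, y', \<epsilon>)) \<le> T / q ^ n * \<epsilon> ^ n"
          using q(1) by (simp add: field_simps)
        have "c * norm (y' - h \<epsilon> x0) \<le> norm (?P n (x0, y', \<epsilon>) - ?P n (x0, h \<epsilon> x0, \<epsilon>))"
          using y'b elim(5) \<epsilon> by (intro expand) (auto simp: dist_commute)
        also have "\<dots> \<le> norm (?P n (x0, y', \<epsilon>)) + norm (?P n (x0, h \<epsilon> x0, \<epsilon>))" by (rule norm_triangle_ineq4)
        also have "\<dots> \<le> T / q ^ n * \<epsilon> ^ n + Ch * \<epsilon> ^ n" using P' elim(4) by (rule add_mono)
        finally have "norm (y' - h \<epsilon> x0) \<le> (T / q ^ n + Ch) / c * \<epsilon> ^ n"
          using c by (simp add: field_simps)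
        moreover have "norm (y - h \<epsilon> x0) \<le> norm (y - y') + norm (y' - h \<epsilon> x0)"
          using norm_triangle_ineq[of "y - y'" "y' - h \<epsilon> x0"] by simp
        ultimately have "norm (y - h \<epsilon> x0) \<le> T * \<epsilon> ^ n + (T / q ^ n + Ch) / c * \<epsilon> ^ n"
          using tol by linarith
        then show "norm (y - h \<epsilon> x0) \<le> C * \<epsilon> ^ (m + 1)"
          unfolding C_def n_def by (simp add: distrib_right)
      qed
    qed
    then show "\<exists>C. \<forall>\<^sub>F \<epsilon> in at_right 0. \<forall>seed y.
      algorithm_output (F_map f g \<epsilon> (H \<epsilon>) m x0) (TOL \<epsilon>) seed y \<and> dist y ?b < \<rho> / 2 \<longrightarrow>
              norm (y - h \<epsilon> x0) \<le> C * \<epsilon> ^ (m + 1)" by blast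
  qed
qed

end
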